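(* For all fixed integers $p\ge 1$ and $m\ge 1$, as $n\to\infty$, $$\sum_{k=1}^{n-1} \frac{(\log k)^p}{n-k} = (\log n)^{p+1} +\gamma (\log n)^{p} + \sum_{r=1}^{p} c_{p,r} (\log n)^{p-r} -\sum_{k=1}^m \Big( \frac{(-1)^k B_k}{k^2} \sum_{r=1}^{p} d_{p,r,k} (\log n)^{p-r} -(-1)^p \zeta^{(p)}(1-k) \Big) \frac{1}{n^k} +O\Big(\frac{(\log n)^{p-1}}{n^{m+1}}\Big),$$ where $c_{p,r} := \dfrac{(-1)^r p!}{(p-r)!}\, \zeta(r+1)$ and $d_{p,r,k} := \dfrac{(-1)^r p!}{(p-r)!}\, S_{r-1,1,k-1}$. Hence the constant term of the expansion is $(-1)^p\, p!\, \zeta(p+1)$.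
   Context: $B_k$ are the Bernoulli numbers defined by $\frac{t}{e^t-1}=\sum_k B_k\frac{t^k}{k!}$ (so $B_1=-\frac12$); $\gamma$ is Euler's constant; $\zeta^{(p)}$ is the $p$-th derivative of the (analytically continued) Riemann zeta function. $S_{r,s,t}:=\sum_{s\le i_1<\dots<i_r\le t}\frac{1}{i_1\cdots i_r}$ (sum over integers), which is $0$ for $r\ge 1$ and $t<r+s-1$; $S_{0,s,t}:=1$ if $t\ge s-1$, and $S_{r,s,t}:=0$ if $r<0$. *)

theory Defs
  imports "HOL-Complex_Analysis.Complex_Analysis" "HOL-Library.Landau_Symbols"
begin

definition bernoulli :: "nat \<Rightarrow> real" where
  "bernoulli k = fact k * fps_nth (fps_X / (fps_exp 1 - 1)) k"

(* The analytic continuation of the Dirichlet series to the complex plane without 1.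
   By the identity theorem it is unique there; the value at the pole 1 is unspecified
   and must not be relied upon. *)
definition zeta :: "complex \<Rightarrow> complex" where
  "zeta = (SOME f. f holomorphic_on - {1} \<and>
     (\<forall>s. Re s > 1 \<longrightarrow> (\<lambda>n. of_nat (Suc n) powr (- s)) sums f s))"

(* An increasing tuple s <= i_1 < ... < i_r <= t is encoded as its set of entries.
   The conventions for degenerate arguments follow: for r < 0, and for r > 0 with
   t < r + s - 1, the index set is empty; for r = 0 only the empty product occurs. *)
definition S_sum :: "int \<Rightarrow> int \<Rightarrow> int \<Rightarrow> real" where
  "S_sum r s t = (\<Sum>I | I \<subseteq> {s..t} \<and> int (card I) = r. \<Prod>i\<in>I. 1 / of_int i)"

definition c_coeff :: "nat \<Rightarrow> nat \<Rightarrow> complex" where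
  "c_coeff p r = (-1) ^ r * fact p / fact (p - r) * zeta (of_nat (r + 1))"

definition d_coeff :: "nat \<Rightarrow> nat \<Rightarrow> nat \<Rightarrow> real" where
  "d_coeff p r k = (-1) ^ r * fact p / fact (p - r) * S_sum (int r - 1) 1 (int k - 1)"

end

theory Submission
  imports Defs
begin

text \<open>
  Since $(\log k)^p$ is the $p$-th derivative of $k^u$ at $u = 0$, the expansion is the $p$-th
  derivative at $u = 0$ of an expansion of $F_n(u) = \sum_{k<n} k^u/(n-k)$ that holds uniformly
  for complex $|u| \le 1/2$, namely
  \[ F_n(u) = n^u \Big(\log n - \psi(1+u) - \sum_{j=1}^{M} \frac{B_j}{j!}
       \frac{u(u-1)\cdots(u-j+1)}{j\, n^j}\Big) + \sum_{k=1}^{M} \frac{\zeta(1-k-u)}{n^k}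
       + O(n^{-M-1/2}) \]
  (lemma \<open>power_conv_asymp\<close>). Everything here is holomorphic in $u$, so Cauchy's inequality turns the
  uniform bound for the error into a bound for its derivatives. On the right-hand side the
  Leibniz rule produces the powers of $\log n$ from $n^u$; the Taylor coefficients of
  $-\psi(1+u) = \gamma + \sum_{r \ge 1} (-1)^r \zeta(r+1) u^r$ give $\gamma$ and the $c_{p,r}$,
  those of $u(u-1)\cdots(u-k+1)$ give the $d_{p,r,k}$, and the last sum gives $\zeta^{(p)}(1-k)$.
  The factor $n^u$ costs $n^{1/2}$ in the error. Expanding one term further than required absorbs
  this loss, because the additional term is visibly of the claimed order.

  For the uniform expansion, note that $k^u/(n-k)$ is not smooth at $k = 0$ and has a pole at
  $k = n$. The identity
  \[ \frac{k^u}{n-k} = \sum_{i<L} \frac{k^{u+i}}{n^{i+1}} + \frac{n^u}{n-k}\Big(\frac kn\Big)^{u+L} \]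
  makes the behaviour at $0$ as smooth as desired, at the price of power sums
  $\sum_{k<n} k^{u+i}$, whose expansion has the constant term $\zeta(-u-i)$
  (\<open>power_sum_asymp\<close>). In the last summand, subtracting $n^u/(n-k)$ removes the pole: with $v = u + L$
  and $x = k/n$ there remains, up to the factor $-n^{u-1}$, the difference quotient
  $(x^v-1)/(x-1)$, which is the integral of $v(1-t+tx)^{v-1}$ over $0 \le t \le 1$. The powers
  inside the integral are easily expanded for each $t$, and the result is integrated over $t$
  (\<open>weighted_power_sum_asymp\<close>). The subtracted terms add up to a harmonic number. The
  coefficients that depend on $L$ cancel by a telescoping sum of falling factorials.

  All asymptotics rest on a single form of the Euler--Maclaurin formula for one step
  (\<open>euler_maclaurin_step\<close>), which is Taylor's formula combined with the recurrence of the Bernoulli numbers.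
  Applied to $k^{w-1}$ it also yields the analytic continuation of $\zeta$: the constant in the
  expansion of $w \sum_{k<n} k^{w-1}$ is a locally uniform limit of holomorphic functions of $w$ and equals
  $w\,\zeta(1-w)$.
\<close>

section \<open>Bernoulli numbers and one Euler--Maclaurin step\<close>

text \<open>
  The number $B_j/j!$, the form in which Bernoulli numbers enter every expansion below.
\<close>
definition bern_coeff :: "nat \<Rightarrow> real" where
  "bern_coeff j = fps_nth (fps_X / (fps_exp 1 - 1)) j"

text \<open>
  Comparing coefficients in $\frac{X}{e^X-1}(e^X-1) = X$.
\<close>
lemma bern_coeff_recurrence:
  "(\<Sum>j<q. bern_coeff j / fact (q - j)) = (if q = 1 then 1 else 0)"
proof -
  define D :: "real fps" where "D = fps_exp 1 - 1"
  have nz: "D \<noteq> 0"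
    unfolding D_def using fps_exp_neq_0 by (auto simp: fps_eq_iff intro!: exI[of _ 1])
  have "subdegree D = 1"
    by (rule subdegreeI) (auto simp: D_def)
  then have "D dvd fps_X"
    using nz by (subst fps_dvd_iff) auto
  then have *: "(fps_X / D) * D = fps_X"
    by simp
  have "fps_nth ((fps_X / D) * D) q = (\<Sum>j=0..q. bern_coeff j * fps_nth D (q - j))"
    by (simp add: fps_mult_nth bern_coeff_def D_def)
  also have "\<dots> = (\<Sum>j<q. bern_coeff j / fact (q - j))"
    by (rule sum.mono_neutral_cong_right) (auto simp: D_def not_less divide_simps)
  finally show ?thesis using * by simp
qed

lemma bern_coeff_0 [simp]: "bern_coeff 0 = 1"
  using bern_coeff_recurrence[of 1] by simp

lemma bernoulli_eq: "bernoulli k = fact k * bern_coeff k"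
  by (simp add: bernoulli_def bern_coeff_def)

definition bern_abs_sum :: "nat \<Rightarrow> real" where
  "bern_abs_sum N = (\<Sum>j\<le>N. \<bar>bern_coeff j\<bar>)"

lemma bern_abs_sum_ge_0: "bern_abs_sum N \<ge> 0"
  by (simp add: bern_abs_sum_def sum_nonneg)

text \<open>
  Here $f_1$ is summed, $f_0$ is its antiderivative and $f_{j+1} = f_j'$. Expanding each difference
  $f_j(a+h) - f_j(a)$ around $a$, the Bernoulli recurrence annihilates the coefficients of all
  $f_q(a)$ except $q = 1$. Only the Taylor remainders survive, and their bound is explicit enough to be
  uniform in parameters of $f$.
\<close>
lemma euler_maclaurin_step:
  fixes f :: "nat \<Rightarrow> complex \<Rightarrow> complex" and a h :: complex
  assumes N: "N \<ge> 1"
    and deriv: "\<And>j z. j \<le> N \<Longrightarrow> z \<in> closed_segment a (a + h) \<Longrightarrow>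
          (f j has_field_derivative f (Suc j) z) (at z within closed_segment a (a + h))"
    and bound: "\<And>z. z \<in> closed_segment a (a + h) \<Longrightarrow> norm (f (Suc N) z) \<le> M"
  shows "norm (h * f 1 a - (\<Sum>j\<le>N. bern_coeff j * h ^ j * (f j (a + h) - f j a)))
           \<le> bern_abs_sum N * M * norm h ^ Suc N"
proof -
  have M: "M \<ge> 0"
    using bound[of a] norm_ge_zero[of "f (Suc N) a"] by (simp del: norm_ge_zero)
  define T where "T j = (\<Sum>l=1..N-j. h ^ l / fact l * f (j + l) a)" for j
  have taylor: "norm (f j (a + h) - f j a - T j) \<le> M * norm h ^ Suc (N - j)" if "j \<le> N" for j
  proof -
    have "norm (f (j+0) (a + h) - (\<Sum>i\<le>N-j. f (j + i) a * (a + h - a) ^ i / fact i))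
            \<le> M * norm (a + h - a) ^ Suc (N - j) / fact (N - j)"
    proof (rule field_Taylor[of "closed_segment a (a + h)" "N - j" "\<lambda>i. f (j + i)"])
      fix i x assume "x \<in> closed_segment a (a + h)" "i \<le> N - j"
      then show "(f (j + i) has_field_derivative f (j + Suc i) x) (at x within closed_segment a (a + h))"
        using deriv[of "j + i" x] that by simp
    next
      fix x assume "x \<in> closed_segment a (a + h)"
      then show "norm (f (j + Suc (N - j)) x) \<le> M" using bound that by simp
    qed auto
    also have "\<dots> \<le> M * norm h ^ Suc (N - j) / 1"
      using mult_left_mono[OF fact_ge_1[of "N - j"], of "M * norm h ^ Suc (N - j)"] M
      by (simp add: divide_simps)
    also have "(\<Sum>i\<le>N-j. f (j + i) a * (a + h - a) ^ i / fact i) = f j a + T j"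
      unfolding T_def atLeast0AtMost[symmetric]
      by (subst sum.atLeast_Suc_atMost) (auto simp: mult_ac)
    finally show ?thesis by (simp add: algebra_simps)
  qed
  \<comment> \<open>Collecting the Taylor coefficients by the order of the derivative leaves the
      Bernoulli recurrence.\<close>
  have main: "(\<Sum>j\<le>N. bern_coeff j * h ^ j * T j) = h * f 1 a"
  proof -
    have "(\<Sum>j\<le>N. bern_coeff j * h ^ j * T j)
        = (\<Sum>j\<le>N. \<Sum>l=1..N-j. bern_coeff j / fact l * h ^ (j + l) * f (j + l) a)"
      by (simp add: T_def sum_distrib_left power_add mult_ac)
    also have "\<dots> = (\<Sum>q=1..N. \<Sum>j<q. bern_coeff j / fact (q - j) * h ^ q * f q a)"
      unfolding sum.Sigma[OF finite_atMost ballI[OF finite_atLeastAtMost]]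
        sum.Sigma[OF finite_atLeastAtMost ballI[OF finite_lessThan]]
      by (rule sum.reindex_bij_witness[of _ "\<lambda>(q, j). (j, q - j)" "\<lambda>(j, l). (j + l, j)"]) auto
    also have "\<dots> = (\<Sum>q=1..N. of_real (\<Sum>j<q. bern_coeff j / fact (q - j)) * (h ^ q * f q a))"
      by (simp add: sum_distrib_right sum_distrib_left mult_ac)
    also have "\<dots> = (\<Sum>q=1..N. if q = 1 then h * f 1 a else 0)"
      unfolding bern_coeff_recurrence by (rule sum.cong) auto
    also have "\<dots> = h * f 1 a" using N by simp
    finally show ?thesis .
  qed
  have "norm (h * f 1 a - (\<Sum>j\<le>N. bern_coeff j * h ^ j * (f j (a + h) - f j a)))
      = norm (\<Sum>j\<le>N. bern_coeff j * h ^ j * (f j (a + h) - f j a - T j))"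
    unfolding main[symmetric]
    by (subst norm_minus_commute) (simp add: sum_subtractf right_diff_distrib)
  also have "\<dots> \<le> (\<Sum>j\<le>N. \<bar>bern_coeff j\<bar> * (M * norm h ^ Suc N))"
  proof (rule sum_norm_le)
    fix j assume j: "j \<in> {..N}"
    have "norm (bern_coeff j * h ^ j * (f j (a + h) - f j a - T j))
        \<le> \<bar>bern_coeff j\<bar> * norm h ^ j * (M * norm h ^ Suc (N - j))"
      unfolding norm_mult norm_power norm_of_real using j
      by (intro mult_left_mono taylor) auto
    also have "\<dots> = \<bar>bern_coeff j\<bar> * (M * norm h ^ (j + Suc (N - j)))"
      by (simp only: power_add mult_ac)
    finally show "norm (bern_coeff j * h ^ j * (f j (a + h) - f j a - T j))
        \<le> \<bar>bern_coeff j\<bar> * (M * norm h ^ Suc N)" using j by simp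
  qed
  also have "\<dots> = bern_abs_sum N * M * norm h ^ Suc N"
    by (simp add: bern_abs_sum_def sum_distrib_right sum_distrib_left mult_ac)
  finally show ?thesis .
qed

lemma euler_maclaurin_sum:
  fixes f :: "nat \<Rightarrow> complex \<Rightarrow> complex" and a h :: complex
  assumes N: "N \<ge> 1"
    and deriv: "\<And>j z. j \<le> N \<Longrightarrow> z \<in> closed_segment a (a + of_nat n * h) \<Longrightarrow>
          (f j has_field_derivative f (Suc j) z) (at z)"
    and bound: "\<And>z. z \<in> closed_segment a (a + of_nat n * h) \<Longrightarrow> norm (f (Suc N) z) \<le> M"
  shows "norm (h * (\<Sum>k<n. f 1 (a + of_nat k * h))
            - (\<Sum>j\<le>N. bern_coeff j * h ^ j * (f j (a + of_nat n * h) - f j a)))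
           \<le> of_nat n * (bern_abs_sum N * M * norm h ^ Suc N)"
proof -
  define x where "x k = a + of_nat k * h" for k
  have x0: "x 0 = a" and xS: "x (Suc k) = x k + h" for k
    by (auto simp: x_def algebra_simps)
  have x_in: "x k \<in> closed_segment a (a + of_nat n * h)" if "k \<le> n" for k
  proof (cases "n = 0")
    case False
    then show ?thesis using that unfolding closed_segment_def
      by (intro CollectI exI[of _ "real k / real n"])
         (auto simp: x_def algebra_simps scaleR_conv_of_real)
  qed (use that in \<open>auto simp: x_def\<close>)
  have sub: "closed_segment (x k) (x k + h) \<subseteq> closed_segment a (a + of_nat n * h)" if "k < n" for k
    using x_in[of k] x_in[of "Suc k"] that xS[of k]
    by (intro closed_segment_subset) auto
  have step: "norm (h * f 1 (x k) - (\<Sum>j\<le>N. bern_coeff j * h ^ j * (f j (x (Suc k)) - f j (x k))))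
                \<le> bern_abs_sum N * M * norm h ^ Suc N" if "k < n" for k
    unfolding xS using sub[OF that] deriv bound
    by (intro euler_maclaurin_step N) (auto intro: has_field_derivative_at_within)
  have tele: "(\<Sum>j\<le>N. bern_coeff j * h ^ j * (f j (x n) - f j (x 0)))
      = (\<Sum>k<n. \<Sum>j\<le>N. bern_coeff j * h ^ j * (f j (x (Suc k)) - f j (x k)))"
    by (subst sum.swap, unfold sum_distrib_left[symmetric], subst sum_lessThan_telescope) (rule refl)
  have "norm (h * (\<Sum>k<n. f 1 (x k)) - (\<Sum>j\<le>N. bern_coeff j * h ^ j * (f j (x n) - f j (x 0))))
      = norm (\<Sum>k<n. h * f 1 (x k) - (\<Sum>j\<le>N. bern_coeff j * h ^ j * (f j (x (Suc k)) - f j (x k))))"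
    unfolding tele by (simp add: sum_subtractf sum_distrib_left)
  also have "\<dots> \<le> (\<Sum>k<n. bern_abs_sum N * M * norm h ^ Suc N)"
    by (rule sum_norm_le) (use step in auto)
  finally show ?thesis by (simp add: x_def x0)
qed

section \<open>Sequences with small increments\<close>

text \<open>
  A comparison with the telescoping bound $k^{-2} \le 2\,(1/k - 1/(k+1))$. The constant $K$ and the
  exponent $a$ are kept explicit because they will depend on a complex parameter.
\<close>
lemma increment_bound:
  fixes G :: "nat \<Rightarrow> complex" and K a :: real
  assumes a: "a \<le> 0" and K: "K \<ge> 0"
    and inc: "\<And>k. k \<ge> 1 \<Longrightarrow> norm (G (Suc k) - G k) \<le> K * real k powr (a - 2)"
    and "1 \<le> n" "n \<le> m"
  shows "norm (G m - G n) \<le> 2 * K * real n powr a * (1 / n - 1 / m)"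
  using \<open>n \<le> m\<close>
proof (induction m rule: dec_induct)
  case (step m)
  have m: "m \<ge> 1" using step \<open>1 \<le> n\<close> by simp
  have "real m powr (a - 2) = real m powr a / real m ^ 2"
    using m by (simp add: powr_diff)
  also have "\<dots> \<le> real n powr a / real m ^ 2"
    using a step \<open>1 \<le> n\<close> by (intro divide_right_mono powr_mono2') auto
  also have "\<dots> \<le> real n powr a * (2 * (1 / real m - 1 / real (Suc m)))"
  proof -
    have "1 / real m ^ 2 \<le> 2 * (1 / real m - 1 / real (Suc m))"
    proof -
      have "1 / real m ^ 2 = 2 / (real m * (2 * real m))"
        using m by (simp add: power2_eq_square)
      also have "\<dots> \<le> 2 / (real m * real (Suc m))"
        using m by (intro divide_left_mono mult_left_mono) auto
      also have "\<dots> = 2 * (1 / real m - 1 / real (Suc m))"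
        using m by (simp add: field_simps)
      finally show ?thesis .
    qed
    then show ?thesis
      by (metis mult_left_mono powr_ge_zero mult.right_neutral times_divide_eq_right)
  qed
  finally have "norm (G (Suc m) - G m) \<le> K * (real n powr a * (2 * (1 / real m - 1 / real (Suc m))))"
    using inc[OF m] K by (meson mult_left_mono order_trans)
  then have "norm (G (Suc m) - G n)
      \<le> K * (real n powr a * (2 * (1 / real m - 1 / real (Suc m)))) + 2 * K * real n powr a * (1 / n - 1 / m)"
    using step.IH norm_triangle_ineq[of "G (Suc m) - G m" "G m - G n"] by simp
  then show ?case by (simp add: algebra_simps)
qed auto

text \<open>
  A partial sum minus its Euler--Maclaurin expansion is such a sequence; the limit is the constant
  in the asymptotic expansion, and the second claim is its error term.
\<close>
lemma increment_bound_limit: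
  fixes G :: "nat \<Rightarrow> complex" and K a :: real
  assumes a: "a \<le> 0" and K: "K \<ge> 0"
    and inc: "\<And>k. k \<ge> 1 \<Longrightarrow> norm (G (Suc k) - G k) \<le> K * real k powr (a - 2)"
  shows "convergent G"
    and "\<And>n. 1 \<le> n \<Longrightarrow> norm (G n - lim G) \<le> 2 * K * real n powr (a - 1)"
proof -
  have bnd: "norm (G m - G n) \<le> 2 * K * real n powr (a - 1)" if "1 \<le> n" "n \<le> m" for m n
  proof -
    have "norm (G m - G n) \<le> 2 * K * real n powr a * (1 / n - 1 / m)"
      using increment_bound[OF a K inc that] .
    also have "\<dots> \<le> 2 * K * real n powr a * (1 / n)"
      using K by (intro mult_left_mono) auto
    finally show ?thesis using that by (simp add: powr_diff)
  qed
  have "Cauchy G"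
  proof (rule CauchyI)
    fix e :: real assume "e > 0"
    obtain n0 where n0: "real n0 > 4 * (K + 1) / e" using reals_Archimedean2 by blast
    have n0': "n0 \<ge> 1" using n0 K \<open>e > 0\<close>
      by (metis divide_nonneg_pos less_one not_less of_nat_0 add_nonneg_nonneg mult_nonneg_nonneg
          zero_le_numeral zero_le_one)
    have le: "real n0 powr (a - 1) \<le> real n0 powr (-1)"
      using n0' a by (intro powr_mono) auto
    have lt: "norm (G m - G n0) < e / 2" if "m \<ge> n0" for m
    proof -
      have "norm (G m - G n0) \<le> 2 * K * real n0 powr (-1)"
        using bnd[OF n0' that] le K by (meson mult_left_mono order_trans mult_nonneg_nonneg zero_le_numeral)
      also have "\<dots> < e / 2" using n0 n0' \<open>e > 0\<close> K by (simp add: powr_minus field_simps)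
      finally show ?thesis .
    qed
    show "\<exists>M. \<forall>m\<ge>M. \<forall>n\<ge>M. norm (G m - G n) < e"
    proof (intro exI[of _ n0] allI impI)
      fix m n assume "n0 \<le> m" "n0 \<le> n"
      then have "norm ((G m - G n0) - (G n - G n0)) < e / 2 + e / 2"
        using lt[of m] lt[of n] norm_triangle_ineq4[of "G m - G n0" "G n - G n0"] by linarith
      then show "norm (G m - G n) < e" by simp
    qed
  qed
  then show conv: "convergent G" by (simp add: Cauchy_convergent_iff)
  fix n :: nat assume n: "1 \<le> n"
  have "(\<lambda>m. norm (G m - G n)) \<longlonglongrightarrow> norm (lim G - G n)"
    using conv by (intro tendsto_intros) (simp add: convergent_LIMSEQ_iff)
  then show "norm (G n - lim G) \<le> 2 * K * real n powr (a - 1)"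
    by (subst norm_minus_commute)
       (rule tendsto_upperbound,
        use bnd[OF n] in \<open>auto simp: eventually_at_top_linorder intro!: exI[of _ n]\<close>)
qed


section \<open>Power sums and the continuation of the zeta function\<close>

definition falling_fact :: "complex \<Rightarrow> nat \<Rightarrow> complex" where
  "falling_fact w j = (\<Prod>i<j. w - of_nat i)"

lemma falling_fact_0 [simp]: "falling_fact w 0 = 1"
  and falling_fact_Suc: "falling_fact w (Suc j) = falling_fact w j * (w - of_nat j)"
  by (simp_all add: falling_fact_def)

lemma falling_fact_Suc_shift: "falling_fact w (Suc j) = w * falling_fact (w - 1) j"
  unfolding falling_fact_def by (subst prod.lessThan_Suc_shift) (simp add: algebra_simps)

lemma norm_falling_fact_le: "norm (falling_fact w j) \<le> (norm w + real j) ^ j"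
proof -
  have "norm (falling_fact w j) = (\<Prod>i<j. norm (w - of_nat i))"
    by (simp add: falling_fact_def prod_norm)
  also have "\<dots> \<le> (\<Prod>i<j. norm w + real j)"
  proof (rule prod_mono)
    fix i assume "i \<in> {..<j}"
    then show "0 \<le> norm (w - of_nat i) \<and> norm (w - of_nat i) \<le> norm w + real j"
      using norm_triangle_ineq4[of w "of_nat i"] by simp
  qed
  finally show ?thesis by simp
qed

lemma holomorphic_falling_fact [holomorphic_intros]:
  "f holomorphic_on A \<Longrightarrow> (\<lambda>z. falling_fact (f z) j) holomorphic_on A"
  unfolding falling_fact_def by (intro holomorphic_intros)

lemma falling_fact_powr_has_field_derivative:
  assumes "z \<notin> \<real>\<^sub>\<le>\<^sub>0"
  shows "((\<lambda>z. falling_fact w j * z powr (w - of_nat j)) has_field_derivative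
           falling_fact w (Suc j) * z powr (w - of_nat (Suc j))) (at z within S)"
  using assms by (auto intro!: derivative_eq_intros simp: falling_fact_Suc algebra_simps)

text \<open>
  The Euler--Maclaurin expansion of $w \sum_{k<n} k^{w-1}$ without its constant term. Multiplying the
  sum by $w$ makes all coefficients polynomials in $w$, and the pole of $\zeta(1-w)$ at $w = 0$
  disappears.
\<close>
definition power_sum_expansion :: "nat \<Rightarrow> complex \<Rightarrow> nat \<Rightarrow> complex" where
  "power_sum_expansion N w n = (\<Sum>j\<le>N. bern_coeff j * falling_fact w j * of_nat n powr (w - of_nat j))"

definition power_sum_error :: "nat \<Rightarrow> complex \<Rightarrow> nat \<Rightarrow> complex" where
  "power_sum_error N w n = w * (\<Sum>k=1..<n. of_nat k powr (w - 1)) - power_sum_expansion N w n"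

lemma power_sum_error_increment:
  assumes N: "N \<ge> 1" and w: "Re w \<le> real N - 1" and k: "k \<ge> 1"
  shows "norm (power_sum_error N w (Suc k) - power_sum_error N w k)
           \<le> bern_abs_sum N * norm (falling_fact w (Suc N)) * real k powr ((Re w - N + 1) - 2)"
proof -
  define f where "f j z = falling_fact w j * z powr (w - of_nat j)" for j z
  have seg: "\<exists>x\<ge>real k. z = of_real x" if z: "z \<in> closed_segment (of_nat k) (of_nat k + 1)" for z :: complex
  proof -
    obtain u where "0 \<le> u" "z = (1 - u) *\<^sub>R of_nat k + u *\<^sub>R (of_nat k + 1)"
      using z by (auto simp only: closed_segment_def)
    then show ?thesis
      by (intro exI[of _ "real k + u"]) (auto simp: scaleR_conv_of_real algebra_simps)
  qed
  have "norm (1 * f 1 (of_nat k) - (\<Sum>j\<le>N. complex_of_real (bern_coeff j) * 1 ^ j * (f j (of_nat k + 1) - f j (of_nat k))))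
      \<le> bern_abs_sum N * (norm (falling_fact w (Suc N)) * real k powr (Re w - N - 1)) * norm (1::complex) ^ Suc N"
  proof (rule euler_maclaurin_step[OF N])
    fix j z assume "z \<in> closed_segment (of_nat k) (of_nat k + 1 :: complex)"
    then obtain x where "x \<ge> real k" "z = of_real x" using seg by blast
    then show "(f j has_field_derivative f (Suc j) z) (at z within closed_segment (of_nat k) (of_nat k + 1))"
      unfolding f_def using k by (intro falling_fact_powr_has_field_derivative) (auto simp: complex_nonpos_Reals_iff)
  next
    fix z assume "z \<in> closed_segment (of_nat k) (of_nat k + 1 :: complex)"
    then obtain x where x: "x \<ge> real k" "z = of_real x" using seg by blast
    then have "norm (f (Suc N) z) = norm (falling_fact w (Suc N)) * x powr (Re w - N - 1)"
      using k by (simp add: f_def norm_mult norm_powr_real_powr algebra_simps)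
    also have "\<dots> \<le> norm (falling_fact w (Suc N)) * real k powr (Re w - N - 1)"
      using x k w by (intro mult_left_mono powr_mono2') auto
    finally show "norm (f (Suc N) z) \<le> norm (falling_fact w (Suc N)) * real k powr (Re w - N - 1)" .
  qed
  moreover have eq: "power_sum_error N w (Suc k) - power_sum_error N w k
      = 1 * f 1 (of_nat k) - (\<Sum>j\<le>N. complex_of_real (bern_coeff j) * 1 ^ j * (f j (of_nat k + 1) - f j (of_nat k)))"
    using k by (simp add: power_sum_error_def power_sum_expansion_def f_def falling_fact_Suc algebra_simps sum_subtractf)
  moreover have "Re w - N + 1 - 2 = Re w - N - 1" by simp
  ultimately show ?thesis by (simp only: eq norm_one power_one mult_1_right mult.assoc)
qed

definition power_sum_const :: "nat \<Rightarrow> complex \<Rightarrow> complex" where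
  "power_sum_const N w = lim (power_sum_error N w)"

lemma
  assumes N: "N \<ge> 1" and w: "Re w \<le> real N - 1"
  shows power_sum_error_tendsto: "power_sum_error N w \<longlonglongrightarrow> power_sum_const N w"
    and power_sum_error_error: "n \<ge> 1 \<Longrightarrow> norm (power_sum_error N w n - power_sum_const N w)
           \<le> 2 * (bern_abs_sum N * norm (falling_fact w (Suc N))) * real n powr (Re w - N)"
proof -
  note * = increment_bound_limit[where G = "power_sum_error N w" and K = "bern_abs_sum N * norm (falling_fact w (Suc N))"
      and a = "Re w - N + 1", OF _ _ power_sum_error_increment[OF N w]]
  show "power_sum_error N w \<longlonglongrightarrow> power_sum_const N w"
    unfolding power_sum_const_def using * bern_abs_sum_ge_0 w by (simp add: convergent_LIMSEQ_iff)
  show "norm (power_sum_error N w n - power_sum_const N w)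
           \<le> 2 * (bern_abs_sum N * norm (falling_fact w (Suc N))) * real n powr (Re w - N)" if "n \<ge> 1"
    unfolding power_sum_const_def using *(2)[OF _ _ _ that] bern_abs_sum_ge_0 w by simp
qed

text \<open>
  The error bound is locally uniform in $w$, so the limit inherits holomorphy.
\<close>
lemma holomorphic_power_sum_const:
  assumes N: "N \<ge> 1"
  shows "power_sum_const N holomorphic_on {w. Re w < real N - 1}"
proof (rule holomorphic_uniform_sequence)
  show "open {w. Re w < real N - 1}" by (rule open_halfspace_Re_lt)
  show "(\<lambda>w. power_sum_error N w (Suc n)) holomorphic_on {w. Re w < real N - 1}" for n
    unfolding power_sum_error_def power_sum_expansion_def by (intro holomorphic_intros) auto
  fix x :: complex assume x: "x \<in> {w. Re w < real N - 1}"
  then obtain d where d: "d > 0" "cball x d \<subseteq> {w. Re w < real N - 1}"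
    using open_contains_cball open_halfspace_Re_lt by blast
  define R where "R = norm x + d + real (Suc N)"
  define K where "K = 2 * (bern_abs_sum N * R ^ Suc N)"
  have bnd: "norm (power_sum_error N w (Suc n) - power_sum_const N w) \<le> K * (1 / real (Suc n))" if "w \<in> cball x d" for w n
  proof -
    have w: "Re w < real N - 1" using d that by auto
    have "norm w \<le> norm x + d"
      using that norm_triangle_ineq3[of w x] by (simp add: dist_norm norm_minus_commute)
    then have "(norm w + real (Suc N)) ^ Suc N \<le> R ^ Suc N"
      unfolding R_def by (intro power_mono) auto
    then have ff: "norm (falling_fact w (Suc N)) \<le> R ^ Suc N"
      using norm_falling_fact_le[of w "Suc N"] by linarith
    have "norm (power_sum_error N w (Suc n) - power_sum_const N w)
        \<le> 2 * (bern_abs_sum N * norm (falling_fact w (Suc N))) * real (Suc n) powr (Re w - N)"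
      using w by (intro power_sum_error_error N) auto
    also have "\<dots> \<le> K * real (Suc n) powr (- 1)"
      unfolding K_def using w ff bern_abs_sum_ge_0[of N]
      by (intro mult_mono powr_mono) (auto simp: R_def d(1) less_imp_le)
    finally show ?thesis by (simp add: powr_minus_divide)
  qed
  have "uniform_limit (cball x d) (\<lambda>n w. power_sum_error N w (Suc n)) (power_sum_const N) sequentially"
  proof (rule uniform_limitI)
    fix e :: real assume e: "e > 0"
    have "(\<lambda>n. K * (1 / real (Suc n))) \<longlonglongrightarrow> K * 0"
      by (intro tendsto_intros LIMSEQ_Suc[OF lim_1_over_n])
    then have "\<forall>\<^sub>F n in sequentially. K * (1 / real (Suc n)) < e"
      using e by (simp add: order_tendsto_iff)
    then show "\<forall>\<^sub>F n in sequentially. \<forall>w\<in>cball x d. dist (power_sum_error N w (Suc n)) (power_sum_const N w) < e"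
      unfolding dist_norm by (rule eventually_mono) (blast intro: le_less_trans bnd)
  qed
  then show "\<exists>d>0. cball x d \<subseteq> {w. Re w < real N - 1} \<and>
      uniform_limit (cball x d) (\<lambda>n w. power_sum_error N w (Suc n)) (power_sum_const N) sequentially"
    using d by blast
qed

lemma of_nat_powr_tendsto_0:
  assumes "Re w < 0"
  shows "(\<lambda>n. of_nat n powr w :: complex) \<longlonglongrightarrow> 0"
proof (rule tendsto_norm_zero_cancel)
  have "(\<lambda>n. real n powr Re w) \<longlonglongrightarrow> 0"
    using assms by (intro tendsto_neg_powr filterlim_real_sequentially)
  then show "(\<lambda>n. norm (of_nat n powr w :: complex)) \<longlonglongrightarrow> 0"
    by (simp add: norm_powr_real_powr)
qed

text \<open>
  The further terms of a longer expansion tend to zero in the smaller half-plane. So the functions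
  for different lengths fit together to one function on the whole plane.
\<close>
lemma power_sum_const_mono:
  assumes N: "N \<ge> 1" "N \<le> M" and w: "Re w < real N - 1"
  shows "power_sum_const M w = power_sum_const N w"
  using \<open>N \<le> M\<close>
proof (induction M rule: dec_induct)
  case (step M)
  have "(\<lambda>n. power_sum_error M w n - bern_coeff (Suc M) * falling_fact w (Suc M) * of_nat n powr (w - of_nat (Suc M)))
      \<longlonglongrightarrow> power_sum_const M w - bern_coeff (Suc M) * falling_fact w (Suc M) * 0"
    using N w step by (intro tendsto_intros power_sum_error_tendsto of_nat_powr_tendsto_0) auto
  also have "(\<lambda>n. power_sum_error M w n - bern_coeff (Suc M) * falling_fact w (Suc M) * of_nat n powr (w - of_nat (Suc M)))
      = power_sum_error (Suc M) w"
    by (simp add: fun_eq_iff power_sum_error_def power_sum_expansion_def algebra_simps)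
  finally have "power_sum_error (Suc M) w \<longlonglongrightarrow> power_sum_const M w" by simp
  moreover have "power_sum_error (Suc M) w \<longlonglongrightarrow> power_sum_const (Suc M) w"
    using N w step by (intro power_sum_error_tendsto) auto
  ultimately show ?case using step.IH LIMSEQ_unique by metis
qed auto

text \<open>
  For $\mathrm{Re}\,w < 0$ the whole expansion tends to zero, and what remains is the Dirichlet
  series of $\zeta(1-w)$.
\<close>
lemma dirichlet_sums_power_sum_const:
  assumes w: "Re w < 0" and N: "N \<ge> 1"
  shows "(\<lambda>n. of_nat (Suc n) powr (w - 1)) sums (power_sum_const N w / w)"
proof -
  have w0: "w \<noteq> 0" using w by auto
  have "(\<lambda>n. power_sum_error N w n + power_sum_expansion N w n) \<longlonglongrightarrow> power_sum_const N w + 0"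
  proof (intro tendsto_add power_sum_error_tendsto N)
    have "(\<lambda>n. \<Sum>j\<le>N. bern_coeff j * falling_fact w j * of_nat n powr (w - of_nat j)) \<longlonglongrightarrow> (\<Sum>j\<le>N. bern_coeff j * falling_fact w j * 0)"
      using w by (intro tendsto_intros of_nat_powr_tendsto_0) auto
    then show "power_sum_expansion N w \<longlonglongrightarrow> 0" by (simp add: power_sum_expansion_def[abs_def])
  qed (use w N in auto)
  then have "(\<lambda>n. w * (\<Sum>k=1..<n. of_nat k powr (w - 1)) / w) \<longlonglongrightarrow> power_sum_const N w / w"
    by (intro tendsto_divide) (use w0 in \<open>auto simp: power_sum_error_def\<close>)
  then have "(\<lambda>n. \<Sum>k=1..<Suc n. of_nat k powr (w - 1)) \<longlonglongrightarrow> power_sum_const N w / w"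
    using w0 by (intro LIMSEQ_Suc) simp
  moreover have "(\<Sum>k=1..<Suc n. of_nat k powr (w - 1)) = (\<Sum>k<n. of_nat (Suc k) powr (w - 1))" for n
    by (rule sum.reindex_bij_witness[of _ Suc "\<lambda>k. k - 1"]) auto
  ultimately show ?thesis by (simp add: sums_def)
qed

text \<open>
  At each $s$ the quotient of the constant by $1-s$ is taken with an expansion long enough for this
  $s$; near any point a fixed length serves as well.
\<close>
lemma zeta_continuation_exists:
  "\<exists>f. f holomorphic_on - {1} \<and>
     (\<forall>s. Re s > 1 \<longrightarrow> (\<lambda>n. of_nat (Suc n) powr (- s)) sums f s)"
proof (intro exI conjI allI impI)
  define N where "N s = nat \<lceil>- Re s\<rceil> + 3" for s
  define f where "f s = power_sum_const (N s) (1 - s) / (1 - s)" for s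
  have N: "Re (1 - s) < real (N s) - 1" for s unfolding N_def by simp linarith
  show "(\<lambda>n. of_nat (Suc n) powr (- s)) sums f s" if "Re s > 1" for s
    using dirichlet_sums_power_sum_const[of "1 - s" "N s"] that by (simp add: f_def N_def)
  have "f field_differentiable at s" if "s \<noteq> 1" for s
  proof -
    define M where "M = N (s - 1)"
    define A where "A = {z. Re (1 - z) < real M - 1} - {1 :: complex}"
    have A: "open A" unfolding A_def
      by (intro open_Diff) (use open_halfspace_Re_gt[of "2 - real M"] in \<open>auto simp: algebra_simps\<close>)
    have sA: "s \<in> A" using N[of "s - 1"] that by (simp add: A_def M_def)
    have "(\<lambda>z. power_sum_const M (1 - z)) holomorphic_on A"
    proof -
      have "power_sum_const M \<circ> (\<lambda>z. 1 - z) holomorphic_on A"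
        by (rule holomorphic_on_compose_gen[OF _ holomorphic_power_sum_const[of M]])
           (auto simp: A_def M_def N_def intro!: holomorphic_intros)
      then show ?thesis by (simp add: o_def)
    qed
    then have "(\<lambda>z. power_sum_const M (1 - z) / (1 - z)) holomorphic_on A"
      by (intro holomorphic_intros) (auto simp: A_def)
    moreover have "power_sum_const M (1 - z) / (1 - z) = f z" if "z \<in> A" for z
    proof -
      have "power_sum_const M (1 - z) = power_sum_const (max M (N z)) (1 - z)"
        using that by (intro power_sum_const_mono[symmetric]) (auto simp: A_def M_def N_def)
      also have "\<dots> = power_sum_const (N z) (1 - z)"
        using N[of z] by (intro power_sum_const_mono) (auto simp: N_def)
      finally show ?thesis by (simp add: f_def)
    qed
    ultimately have "f holomorphic_on A" by (simp cong: holomorphic_cong)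
    then show ?thesis using A sA holomorphic_on_imp_differentiable_at by blast
  qed
  then show "f holomorphic_on - {1}"
    by (auto simp: holomorphic_on_def intro: field_differentiable_at_within)
qed

lemma holomorphic_zeta: "zeta holomorphic_on - {1}"
  and zeta_sums: "Re s > 1 \<Longrightarrow> (\<lambda>n. of_nat (Suc n) powr (- s)) sums zeta s"
  using someI_ex[OF zeta_continuation_exists] unfolding zeta_def by blast+

text \<open>
  Both sides are holomorphic and agree on the half-plane of absolute convergence; the punctured
  half-plane is connected.
\<close>
lemma zeta_eq_power_sum_const:
  assumes N: "N \<ge> 1" and w: "Re w < real N - 1" "w \<noteq> 0"
  shows "w * zeta (1 - w) = power_sum_const N w"
proof -
  let ?A = "{w. Re w < real N - 1} - {0}" and ?B = "{w. Re w < 0}"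
  show ?thesis
  proof (rule analytic_continuation_open[of ?B ?A "\<lambda>w. w * zeta (1 - w)" "power_sum_const N"])
    show "open ?B" "open ?A" by (auto intro: open_halfspace_Re_lt)
    show "?B \<noteq> {}" by (auto intro!: exI[of _ "- 1"])
    show "connected ?A"
      by (intro connected_open_delete open_halfspace_Re_lt convex_connected convex_halfspace_Re_lt) auto
    show "?B \<subseteq> ?A" using N by auto
    show "(\<lambda>w. w * zeta (1 - w)) holomorphic_on ?A"
    proof -
      have "zeta \<circ> (\<lambda>z. 1 - z) holomorphic_on ?A"
        by (rule holomorphic_on_compose_gen[OF _ holomorphic_zeta])
           (auto intro!: holomorphic_intros)
      then have "(\<lambda>w. zeta (1 - w)) holomorphic_on ?A" by (simp add: o_def)
      then show ?thesis by (intro holomorphic_intros)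
    qed
    show "power_sum_const N holomorphic_on ?A"
      using holomorphic_power_sum_const[OF N] by (rule holomorphic_on_subset) auto
    show "z * zeta (1 - z) = power_sum_const N z" if "z \<in> ?B" for z
    proof -
      have "zeta (1 - z) = power_sum_const N z / z"
        using zeta_sums[of "1 - z"] dirichlet_sums_power_sum_const[of z N] that N
        by (intro sums_unique2) auto
      moreover have "z \<noteq> 0" using that by auto
      ultimately show ?thesis by simp
    qed
  qed (use w in auto)
qed

lemma power_sum_asymp:
  assumes N: "N \<ge> 1" and w: "Re w < real N - 1" "w \<noteq> 0" and n: "n \<ge> 1"
  shows "norm (w * (\<Sum>k=1..<n. of_nat k powr (w - 1)) - power_sum_expansion N w n - w * zeta (1 - w))
           \<le> 2 * (bern_abs_sum N * norm (falling_fact w (Suc N))) * real n powr (Re w - N)"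
  using power_sum_error_error[OF N _ n, of w] w zeta_eq_power_sum_const[OF N w] by (simp add: power_sum_error_def)


section \<open>Harmonic numbers\<close>

text \<open>
  The Euler--Maclaurin step is applied to $-1/z$ on $[-n,-1]$ instead of $1/z$ on $[1,n]$. Summing
  over left endpoints then includes $1/n$ and yields coefficients $-B_j/j$ without alternating
  signs, which is literally the form that cancels in the expansion of the weighted sums.
\<close>
lemma harm_asymp:
  assumes N: "N \<ge> 1" and n: "n \<ge> 1"
  shows "norm (harm n - (ln (real n) + euler_mascheroni)
               + (\<Sum>j=1..N. complex_of_real (bern_coeff j) * fact (j - 1) / of_nat n ^ j) :: complex)
           \<le> 2 * (bern_abs_sum N * fact N) / real n ^ N"
proof -
  define f :: "nat \<Rightarrow> complex \<Rightarrow> complex" where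
    "f j z = (case j of 0 \<Rightarrow> - Ln (- z) | Suc i \<Rightarrow> fact i / (- z) ^ Suc i)" for j z
  define G :: "nat \<Rightarrow> complex" where
    "G n = harm n + (\<Sum>j\<le>N. bern_coeff j * f j (- of_nat n))" for n
  have G_eq: "G n = harm n - ln (real n) + (\<Sum>j=1..N. complex_of_real (bern_coeff j) * fact (j - 1) / of_nat n ^ j)"
    if "n \<ge> 1" for n
  proof -
    have "(\<Sum>j\<le>N. bern_coeff j * f j (- of_nat n)) = bern_coeff 0 * f 0 (- of_nat n)
            + (\<Sum>j=1..N. bern_coeff j * f j (- of_nat n))"
      unfolding atLeast0AtMost[symmetric] by (subst sum.atLeast_Suc_atMost) auto
    also have "f 0 (- of_nat n) = - ln (real n)"
      using that by (simp add: f_def Ln_of_nat)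
    also have "(\<Sum>j=1..N. bern_coeff j * f j (- of_nat n))
        = (\<Sum>j=1..N. complex_of_real (bern_coeff j) * fact (j - 1) / of_nat n ^ j)"
      by (intro sum.cong) (auto simp: f_def split: nat.splits)
    finally show ?thesis by (simp add: G_def of_real_harm)
  qed
  have seg: "\<exists>x\<ge>real k. z = - of_real x"
    if z: "z \<in> closed_segment (- of_nat (Suc k)) (- of_nat (Suc k) + 1)" for z :: complex and k
  proof -
    obtain u where "u \<le> 1" "z = (1 - u) *\<^sub>R (- of_nat (Suc k)) + u *\<^sub>R (- of_nat (Suc k) + 1)"
      using z by (auto simp only: closed_segment_def)
    then show ?thesis
      by (intro exI[of _ "real k + 1 - u"]) (auto simp: scaleR_conv_of_real algebra_simps)
  qed
  have inc: "norm (G (Suc k) - G k) \<le> bern_abs_sum N * fact N * real k powr ((1 - real N) - 2)"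
    if k: "k \<ge> 1" for k
  proof -
    let ?a = "- of_nat (Suc k) :: complex"
    have "norm (1 * f 1 ?a - (\<Sum>j\<le>N. complex_of_real (bern_coeff j) * 1 ^ j * (f j (?a + 1) - f j ?a)))
        \<le> bern_abs_sum N * (fact N / real k ^ Suc N) * norm (1::complex) ^ Suc N"
    proof (rule euler_maclaurin_step[OF N])
      fix j z assume "z \<in> closed_segment ?a (?a + 1)"
      then obtain x where x: "x \<ge> real k" "z = - of_real x" using seg by blast
      have "(f j has_field_derivative f (Suc j) z) (at z)"
      proof (cases j)
        case 0
        have "((\<lambda>z. - Ln (- z)) has_field_derivative 1 / (- z)) (at z)"
          using x k by (auto intro!: derivative_eq_intros simp: complex_nonpos_Reals_iff field_simps)
        then show ?thesis by (simp add: 0 f_def[abs_def])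
      next
        case (Suc i)
        have "((\<lambda>z. fact i / (- z) ^ Suc i) has_field_derivative fact (Suc i) / (- z) ^ Suc (Suc i)) (at z)"
        proof -
          have "((\<lambda>z. (- z) ^ Suc i) has_field_derivative of_nat (Suc i) * (- 1 * (- z) ^ (Suc i - Suc 0))) (at z)"
            by (intro DERIV_power) (auto intro!: derivative_eq_intros)
          moreover have nz: "- z \<noteq> 0" using x k by auto
          ultimately have "((\<lambda>z. fact i * inverse ((- z) ^ Suc i)) has_field_derivative
              fact i * (- (of_nat (Suc i) * (- 1 * (- z) ^ (Suc i - Suc 0)) * inverse (((- z) ^ Suc i) ^ Suc (Suc 0))))) (at z)"
            by (intro DERIV_cmult DERIV_inverse_fun) auto
          also have "fact i * (- (of_nat (Suc i) * (- 1 * (- z) ^ (Suc i - Suc 0)) * inverse (((- z) ^ Suc i) ^ Suc (Suc 0))))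
              = fact (Suc i) / (- z) ^ Suc (Suc i)"
            unfolding fact_Suc power_Suc using nz by (simp add: divide_simps)
          finally show ?thesis by (simp only: divide_inverse)
        qed
        then show ?thesis by (simp only: Suc f_def[abs_def] nat.case)
      qed
      then show "(f j has_field_derivative f (Suc j) z) (at z within closed_segment ?a (?a + 1))"
        by (rule has_field_derivative_at_within)
    next
      fix z assume "z \<in> closed_segment ?a (?a + 1)"
      then obtain x where x: "x \<ge> real k" "z = - of_real x" using seg by blast
      then have "norm (f (Suc N) z) = fact N / x ^ Suc N"
        using k by (simp add: f_def norm_divide norm_power norm_mult)
      also have "\<dots> \<le> fact N / real k ^ Suc N"
        using x k by (intro divide_left_mono power_mono mult_pos_pos zero_less_power) auto
      finally show "norm (f (Suc N) z) \<le> fact N / real k ^ Suc N" .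
    qed
    moreover have "G (Suc k) - G k
        = 1 * f 1 ?a - (\<Sum>j\<le>N. complex_of_real (bern_coeff j) * 1 ^ j * (f j (?a + 1) - f j ?a))"
    proof -
      have "f 1 ?a = 1 / of_nat (Suc k)" by (simp add: f_def)
      then show ?thesis
        by (simp add: G_def harm_Suc right_diff_distrib sum_subtractf inverse_eq_divide)
    qed
    moreover have "real k powr ((1 - real N) - 2) = 1 / real k ^ Suc N"
    proof -
      have "(1 - real N) - 2 = - real (Suc N)" by simp
      then show ?thesis
        using k by (simp only: powr_minus_divide powr_realpow)
    qed
    ultimately show ?thesis by simp
  qed
  note lim = increment_bound_limit[where G = G, OF _ _ inc]
  have "G \<longlonglongrightarrow> euler_mascheroni + (\<Sum>j=1..N. 0)"
  proof (rule Lim_transform_eventually)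
    show "(\<lambda>n. of_real (harm n - ln (real n)) + (\<Sum>j=1..N. complex_of_real (bern_coeff j) * fact (j - 1) / of_nat n ^ j) :: complex)
            \<longlonglongrightarrow> euler_mascheroni + (\<Sum>j=1..N. 0)"
    proof (intro tendsto_add tendsto_sum)
      show "(\<lambda>n. complex_of_real (harm n - ln (real n))) \<longlonglongrightarrow> euler_mascheroni"
        using tendsto_of_real[OF euler_mascheroni_LIMSEQ, where ?'a = complex] by simp
      fix j assume "j \<in> {1..N}"
      then have "j > 0" by simp
      then have "(\<lambda>n. complex_of_real (bern_coeff j) * fact (j - 1) * (1 / of_nat n) ^ j :: complex)
          \<longlonglongrightarrow> complex_of_real (bern_coeff j) * fact (j - 1) * 0 ^ j"
        by (intro tendsto_intros lim_1_over_n)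
      then show "(\<lambda>n. complex_of_real (bern_coeff j) * fact (j - 1) / of_nat n ^ j :: complex) \<longlonglongrightarrow> 0"
        using \<open>j > 0\<close> by (simp add: power_divide zero_power)
    qed
    show "\<forall>\<^sub>F n in sequentially. of_real (harm n - ln (real n)) + (\<Sum>j=1..N. complex_of_real (bern_coeff j) * fact (j - 1) / of_nat n ^ j) = G n"
      using eventually_ge_at_top[of 1] by eventually_elim (simp add: G_eq harm_def)
  qed
  then have "lim G = euler_mascheroni" by (simp add: limI)
  moreover have "norm (G n - lim G) \<le> 2 * (bern_abs_sum N * fact N) * real n powr ((1 - real N) - 1)"
    using N n bern_abs_sum_ge_0[of N] by (intro lim(2)) auto
  moreover have "real n powr ((1 - real N) - 1) = 1 / real n ^ N"
    using n by (simp add: powr_minus_divide powr_realpow)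
  ultimately show ?thesis using G_eq[OF n] by (simp add: algebra_simps)
qed


section \<open>Weighted power sums by integration over a parameter\<close>

lemma continuous_on_segment_powr:
  assumes "Re v > 0" "0 \<le> x"
  shows "continuous_on {0..1} (\<lambda>t. complex_of_real (1 - t + t * x) powr v)"
  using assms by (intro continuous_intros) (auto simp: add_nonneg_nonneg)

lemma segment_pos:
  assumes "0 < t" "t < 1" "0 \<le> (x::real)"
  shows "1 - t + t * x > 0"
  using assms by (intro add_pos_nonneg) auto

lemma segment_powr_has_vector_derivative:
  assumes "0 < t" "t < 1" "0 \<le> x"
  shows "((\<lambda>t. complex_of_real (1 - t + t * x) powr v) has_vector_derivative
           of_real (x - 1) * (v * complex_of_real (1 - t + t * x) powr (v - 1))) (at t)"
proof -
  have "((\<lambda>z. (1 - z + z * of_real x) powr v) has_field_derivative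
           of_real (x - 1) * (v * (1 - of_real t + of_real t * of_real x) powr (v - 1))) (at (of_real t))"
    using segment_pos[OF assms]
    by (auto intro!: derivative_eq_intros simp: complex_nonpos_Reals_iff algebra_simps)
  from has_vector_derivative_real_field[OF this] show ?thesis by simp
qed

text \<open>
  This integral representation of the difference quotient replaces a function that is singular at
  $x = 1$ as a formula by a family of pure powers of linear functions.
\<close>
lemma powr_diff_quotient_has_integral:
  assumes v: "Re v > 0" and x: "0 \<le> x" "x < 1"
  shows "((\<lambda>t. v * complex_of_real (1 - t + t * x) powr (v - 1)) has_integral
           (of_real x powr v - 1) / (of_real x - 1)) {0..1}"
proof -
  have "((\<lambda>t. of_real (x - 1) * (v * complex_of_real (1 - t + t * x) powr (v - 1))) has_integral
          complex_of_real (1 - 1 + 1 * x) powr v - complex_of_real (1 - 0 + 0 * x) powr v) {0..1}"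
    using v x
    by (intro fundamental_theorem_of_calculus_interior continuous_on_segment_powr
          segment_powr_has_vector_derivative) auto
  then have "((\<lambda>t. of_real (x - 1) * (v * complex_of_real (1 - t + t * x) powr (v - 1)) / of_real (x - 1))
      has_integral (complex_of_real (1 - 1 + 1 * x) powr v - complex_of_real (1 - 0 + 0 * x) powr v) / of_real (x - 1)) {0..1}"
    by (rule has_integral_divide)
  then show ?thesis using x by simp
qed

text \<open>
  The contribution of the endpoint $x = 0$: up to a factor this is the Beta integral
  $\mathrm{B}(j, v-j+1)$, computed by repeated integration by parts. The result does not depend on
  $v$ and will cancel against the expansion of the harmonic number.
\<close>
lemma beta_has_integral:
  assumes "j \<ge> 1" "real j < Re v"
  shows "((\<lambda>t. falling_fact v j * of_real t ^ (j - 1) * of_real (1 - t) powr (v - of_nat j))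
           has_integral fact (j - 1)) {0..1}"
  using assms
proof (induction j rule: dec_induct)
  case base
  then show ?case using powr_diff_quotient_has_integral[of v 0] by (simp add: falling_fact_def)
next
  case (step j)
  define F where "F t = falling_fact v j * of_real t ^ j * complex_of_real (1 - t) powr (v - of_nat j)" for t
  define g where "g t = falling_fact v j * of_real t ^ (j - 1) * complex_of_real (1 - t) powr (v - of_nat j)" for t
  have "((\<lambda>t. of_nat j * g t
          - falling_fact v (Suc j) * of_real t ^ j * complex_of_real (1 - t) powr (v - of_nat (Suc j)))
        has_integral F 1 - F 0) {0..1}"
  proof (rule fundamental_theorem_of_calculus_interior)
    have "continuous_on {0..1} (\<lambda>t. complex_of_real (1 - t) powr (v - of_nat j))"
      using continuous_on_segment_powr[of "v - of_nat j" 0] step.prems by simp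
    then show "continuous_on {0..1} F"
      unfolding F_def by (intro continuous_on_mult) (auto intro!: continuous_intros)
    fix t :: real assume t: "t \<in> {0<..<1}"
    have "((\<lambda>z. falling_fact v j * z ^ j * (1 - z) powr (v - of_nat j)) has_field_derivative
        of_nat j * (falling_fact v j * of_real t ^ (j - 1) * (1 - of_real t) powr (v - of_nat j))
          - falling_fact v (Suc j) * of_real t ^ j * (1 - of_real t) powr (v - of_nat (Suc j))) (at (of_real t))"
      using t by (auto intro!: derivative_eq_intros simp: complex_nonpos_Reals_iff algebra_simps falling_fact_Suc)
    from has_vector_derivative_real_field[OF this]
    show "(F has_vector_derivative of_nat j * g t
          - falling_fact v (Suc j) * of_real t ^ j * complex_of_real (1 - t) powr (v - of_nat (Suc j))) (at t)"
      by (simp add: F_def[abs_def] g_def)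
  qed simp
  moreover have "((\<lambda>t. of_nat j * g t) has_integral of_nat j * fact (j - 1)) {0..1}"
    unfolding g_def using step by (intro has_integral_mult_right step.IH) auto
  ultimately have "((\<lambda>t. of_nat j * g t - (of_nat j * g t
          - falling_fact v (Suc j) * of_real t ^ j * complex_of_real (1 - t) powr (v - of_nat (Suc j))))
      has_integral of_nat j * fact (j - 1) - (F 1 - F 0)) {0..1}"
    by (rule has_integral_diff[rotated])
  moreover have "of_nat j * fact (j - 1) - (F 1 - F 0) = fact (Suc j - 1)"
    using step by (cases j) (auto simp: F_def)
  ultimately show ?case by simp
qed

lemma power_has_integral:
  assumes "j \<ge> 1"
  shows "((\<lambda>t. complex_of_real t ^ (j - 1)) has_integral 1 / of_nat j) {0..1}"
proof -
  have "((\<lambda>t. complex_of_real t ^ (j - 1)) has_integral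
           of_real 1 ^ j / of_nat j - of_real 0 ^ j / of_nat j) {0..1}"
  proof (rule fundamental_theorem_of_calculus)
    fix t :: real
    have "((\<lambda>z. z ^ j / of_nat j) has_field_derivative complex_of_real t ^ (j - 1)) (at (of_real t))"
      using assms by (auto intro!: derivative_eq_intros)
    from has_vector_derivative_real_field[OF this]
    show "((\<lambda>t. of_real t ^ j / of_nat j) has_vector_derivative complex_of_real t ^ (j - 1)) (at t within {0..1})"
      by simp
  qed simp
  then show ?thesis using assms by (simp add: power_0_left)
qed

lemma one_minus_power_has_integral:
  "((\<lambda>t. (1 - t) ^ k) has_integral (1 / (real k + 1))) {0..1}"
proof -
  have "((\<lambda>t. (1 - t) ^ k) has_integral
           (- ((1 - 1) ^ Suc k / (real k + 1))) - (- ((1 - 0) ^ Suc k / (real k + 1)))) {0..1}"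
  proof (rule fundamental_theorem_of_calculus)
    fix t :: real
    have "((\<lambda>t. - (1 / (real k + 1)) * (1 - t) ^ Suc k) has_field_derivative
            - (1 / (real k + 1)) * (of_nat (Suc k) * (- 1 * (1 - t) ^ (Suc k - Suc 0)))) (at t within {0..1})"
      by (intro DERIV_cmult DERIV_power) (auto intro!: derivative_eq_intros)
    then show "((\<lambda>t. - ((1 - t) ^ Suc k / (real k + 1))) has_vector_derivative (1 - t) ^ k) (at t within {0..1})"
      by (simp add: has_real_derivative_iff_has_vector_derivative[symmetric] add_ac)
  qed simp
  then show ?thesis by simp
qed

text \<open>
  Proved by expanding $1/t$ as a geometric series in $1-t$. The function
  $(1-(1-t)^v)/t$ is bounded on $[0,1]$, so truncating the series after $K$ terms costs at most a
  constant times $\int_0^1 (1-t)^K dt = 1/(K+1)$; the partial sums are those of the defining series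
  of the Digamma function.
\<close>
lemma digamma_has_integral:
  assumes v: "Re v > 0"
  shows "((\<lambda>t. (1 - complex_of_real (1 - t) powr v) / of_real t) has_integral
           (Digamma (v + 1) + euler_mascheroni)) {0..1}"
proof -
  define q where "q t = (if t = 0 then v else (1 - complex_of_real (1 - t) powr v) / of_real t)" for t
  have powr_cont: "continuous_on {0..1} (\<lambda>t. complex_of_real (1 - t) powr v)"
    using continuous_on_segment_powr[of v 0] v by simp
  have "continuous (at t within {0..1}) q" if "t \<in> {0..1}" for t
  proof (cases "t = 0")
    case False
    have "continuous (at t within {0..1}) (\<lambda>t. complex_of_real (1 - t) powr v)"
      using powr_cont that by (simp add: continuous_on_eq_continuous_within)
    then have "continuous (at t within {0..1}) (\<lambda>t. (1 - complex_of_real (1 - t) powr v) / of_real t)"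
      using False unfolding continuous_within
      by (intro tendsto_divide tendsto_diff tendsto_const tendsto_of_real tendsto_ident_at) auto
    moreover have "\<forall>\<^sub>F s in at t within {0..1}. s \<noteq> 0"
      using False by (intro eventually_at_topological[THEN iffD2] exI[of _ "- {0}"]) auto
    ultimately show ?thesis using False
      unfolding continuous_within q_def
      by (auto elim!: Lim_transform_eventually eventually_mono)
  next
    case True
    have "((\<lambda>z. - ((1 - z) powr v)) has_field_derivative v) (at 0)"
      by (auto intro!: derivative_eq_intros)
    then have "((\<lambda>z. (1 - (1 - z) powr v) / z) \<longlongrightarrow> v) (at 0)"
      by (simp add: has_field_derivative_iff)
    moreover have "filterlim complex_of_real (at 0) (at 0 within {0..1})"
      by (intro filterlim_atI tendsto_eq_intros) (auto simp: eventually_at_filter)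
    ultimately have "((\<lambda>t. (1 - complex_of_real (1 - t) powr v) / of_real t) \<longlongrightarrow> v) (at 0 within {0..1})"
      using filterlim_compose by fastforce
    moreover have "\<forall>\<^sub>F s in at 0 within {0..1::real}. s \<noteq> 0"
      by (simp add: eventually_at_filter)
    ultimately show ?thesis using True
      unfolding continuous_within q_def
      by (auto elim!: Lim_transform_eventually eventually_mono)
  qed
  then have q_cont: "continuous_on {0..1} q" by (simp add: continuous_on_eq_continuous_within)
  then have "bounded (q ` {0..1})"
    by (intro compact_imp_bounded compact_continuous_image) auto
  then obtain B where "\<forall>y\<in>q ` {0..1}. norm y \<le> B"
    unfolding bounded_iff by (elim exE)
  then have B: "norm (q t) \<le> B" if "t \<in> {0..1}" for t
    using that by simp
  have q_int: "q integrable_on {0..1}"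
    using q_cont by (rule integrable_continuous_real)
  define D where "D = integral {0..1} q"
  define S where "S K = (\<Sum>i<K. inverse (of_nat (Suc i)) - inverse (v + 1 + of_nat i))" for K
  \<comment> \<open>Multiplying the integrand by 1 - (1 - t)^K truncates the geometric series for 1/t.\<close>
  have S_int: "((\<lambda>t. q t * (1 - complex_of_real (1 - t) ^ K)) has_integral S K) {0..1}" for K
  proof (rule has_integral_spike_finite[of "{0, 1}"])
    show "((\<lambda>t. \<Sum>i<K. of_real ((1 - t) ^ i) - inverse (v + 1 + of_nat i) *
              ((v + 1 + of_nat i) * complex_of_real (1 - t + t * 0) powr (v + 1 + of_nat i - 1)))
            has_integral S K) {0..1}"
      unfolding S_def
    proof (intro has_integral_sum has_integral_diff)
      fix i
      have "((\<lambda>t. complex_of_real ((1 - t) ^ i)) has_integral of_real (1 / (real i + 1))) {0..1}"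
        by (rule has_integral_of_real[OF one_minus_power_has_integral])
      then show "((\<lambda>t. complex_of_real ((1 - t) ^ i)) has_integral inverse (of_nat (Suc i))) {0..1}"
        by (simp add: field_simps)
      have "((\<lambda>t. inverse (v + 1 + of_nat i) *
              ((v + 1 + of_nat i) * complex_of_real (1 - t + t * 0) powr (v + 1 + of_nat i - 1)))
          has_integral inverse (v + 1 + of_nat i) * ((of_real 0 powr (v + 1 + of_nat i) - 1) / (of_real 0 - 1))) {0..1}"
        using v by (intro has_integral_mult_right powr_diff_quotient_has_integral) auto
      then show "((\<lambda>t. inverse (v + 1 + of_nat i) *
              ((v + 1 + of_nat i) * complex_of_real (1 - t + t * 0) powr (v + 1 + of_nat i - 1)))
          has_integral inverse (v + 1 + of_nat i)) {0..1}"
        by simp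
    qed simp
    fix t :: real assume t: "t \<in> {0..1} - {0, 1}"
    have nz: "v + 1 + of_nat i \<noteq> 0" for i
      using v by (auto simp: complex_eq_iff)
    have "(\<Sum>i<K. of_real ((1 - t) ^ i) - inverse (v + 1 + of_nat i) *
              ((v + 1 + of_nat i) * complex_of_real (1 - t + t * 0) powr (v + 1 + of_nat i - 1)))
        = (\<Sum>i<K. complex_of_real (1 - t) ^ i - complex_of_real (1 - t) powr v * complex_of_real (1 - t) ^ i)"
    proof (rule sum.cong)
      fix i
      have "complex_of_real (1 - t) powr (v + of_nat i) = complex_of_real (1 - t) powr v * complex_of_real (1 - t) ^ i"
        using t by (simp add: powr_add powr_nat')
      moreover have "v + 1 + of_nat i - 1 = v + of_nat i" by simp
      ultimately show "of_real ((1 - t) ^ i) - inverse (v + 1 + of_nat i) *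
              ((v + 1 + of_nat i) * complex_of_real (1 - t + t * 0) powr (v + 1 + of_nat i - 1))
          = complex_of_real (1 - t) ^ i - complex_of_real (1 - t) powr v * complex_of_real (1 - t) ^ i"
        using left_inverse[OF nz[of i]]
        by (simp only: mult.assoc[symmetric] mult_1_left mult_zero_right add_0_right of_real_power)
    qed simp
    also have "\<dots> = (1 - complex_of_real (1 - t) powr v) * (\<Sum>i<K. complex_of_real (1 - t) ^ i)"
      by (simp add: sum_distrib_left algebra_simps sum_subtractf)
    also have "\<dots> = q t * (1 - complex_of_real (1 - t) ^ K)"
      using t by (simp add: q_def sum_gp_strict)
    finally show "q t * (1 - complex_of_real (1 - t) ^ K) =
        (\<Sum>i<K. of_real ((1 - t) ^ i) - inverse (v + 1 + of_nat i) *
              ((v + 1 + of_nat i) * complex_of_real (1 - t + t * 0) powr (v + 1 + of_nat i - 1)))" ..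
  qed simp
  have D_S: "norm (D - S K) \<le> B * (1 / (real K + 1))" for K
  proof -
    have "((\<lambda>t. q t - q t * (1 - complex_of_real (1 - t) ^ K)) has_integral D - S K) {0..1}"
      using q_int S_int unfolding D_def by (intro has_integral_diff) auto
    then have *: "((\<lambda>t. q t * complex_of_real (1 - t) ^ K) has_integral D - S K) {0..1}"
      by (simp add: algebra_simps)
    have **: "((\<lambda>t. B * (1 - t) ^ K) has_integral B * (1 / (real K + 1))) {0..1}"
      by (intro has_integral_mult_right one_minus_power_has_integral)
    have "norm (integral {0..1} (\<lambda>t. q t * complex_of_real (1 - t) ^ K)) \<le> integral {0..1} (\<lambda>t. B * (1 - t) ^ K)"
    proof (rule integral_norm_bound_integral)
      fix t :: real assume "t \<in> {0..1}"
      moreover have "norm (complex_of_real (1 - t) ^ K) = \<bar>1 - t\<bar> ^ K"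
        by (simp only: norm_power norm_of_real)
      ultimately show "norm (q t * complex_of_real (1 - t) ^ K) \<le> B * (1 - t) ^ K"
        using B[of t] by (auto simp: norm_mult intro!: mult_right_mono)
    qed (use * ** in blast)+
    then show ?thesis by (simp only: integral_unique[OF *] integral_unique[OF **])
  qed
  have "(\<lambda>K. D - S K) \<longlonglongrightarrow> 0"
  proof (rule Lim_null_comparison)
    show "\<forall>\<^sub>F K in sequentially. norm (D - S K) \<le> B * (1 / (real K + 1))"
      using D_S by (intro always_eventually allI)
    have "(\<lambda>K. B * (1 / real (Suc K))) \<longlonglongrightarrow> B * 0"
      by (rule tendsto_mult[OF tendsto_const LIMSEQ_Suc[OF lim_1_over_n]])
    then show "(\<lambda>K. B * (1 / (real K + 1))) \<longlonglongrightarrow> 0"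
      by (simp add: add.commute)
  qed
  then have "(\<lambda>K. D - (D - S K)) \<longlonglongrightarrow> D - 0"
    by (intro tendsto_intros)
  then have "(\<lambda>i. inverse (of_nat (Suc i)) - inverse (v + 1 + of_nat i)) sums D"
    by (simp add: sums_def S_def)
  then have "D = Digamma (v + 1) + euler_mascheroni"
    by (simp add: Digamma_def sums_iff)
  then have "(q has_integral (Digamma (v + 1) + euler_mascheroni)) {0..1}"
    using q_int D_def by (metis has_integral_integral)
  then show ?thesis
    by (rule has_integral_spike_finite[of "{0}", rotated 2]) (auto simp: q_def)
qed

text \<open>
  The harmonic number minus the weighted sum is $\frac1n \sum_{k<n} \frac{x^v-1}{x-1}$ with $x = k/n$.
  The Euler--Maclaurin formula with step $1/n$ is applied to $v(1-t+tx)^{v-1}$ for fixed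
  $t \in (0,1)$, and its two sides are integrated over $t$. The condition on the real part of $v$
  makes the last derivative bounded uniformly in $t$.
\<close>
lemma weighted_power_sum_asymp:
  assumes N: "N \<ge> 1" and v: "real N + 1 \<le> Re v" and n: "n \<ge> 1"
  shows "norm (harm n - (\<Sum>k=1..<n. (of_nat k / of_nat n) powr v / of_nat (n - k))
                 - (Digamma (v + 1) + euler_mascheroni)
                 - (\<Sum>j=1..N. complex_of_real (bern_coeff j) / of_nat n ^ j * (falling_fact v j / of_nat j - fact (j - 1))))
           \<le> bern_abs_sum N * norm (falling_fact v (Suc N)) / real n ^ N" (is "norm ?E \<le> _")
proof -
  define h where "h = 1 / complex_of_nat n"
  have nh: "of_nat n * h = 1" using n by (simp add: h_def)
  define f where "f t j z = falling_fact v j * (of_real t ^ j / of_real t) * (1 - of_real t + of_real t * z) powr (v - of_nat j)"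
    for t :: real and j z
  \<comment> \<open>The error of the Euler--Maclaurin formula for fixed t, written so that every summand has an
      integral known from the lemmas above; it agrees with that error except at t = 0 and t = 1.\<close>
  define \<phi> where "\<phi> t = h * (\<Sum>k<n. v * complex_of_real (1 - t + t * (real k / real n)) powr (v - 1))
      - ((1 - complex_of_real (1 - t) powr v) / of_real t
         + (\<Sum>j=1..N. bern_coeff j * h ^ j * (falling_fact v j * of_real t ^ (j - 1)
              - falling_fact v j * of_real t ^ (j - 1) * complex_of_real (1 - t) powr (v - of_nat j))))" for t
  have \<phi>_int: "(\<phi> has_integral
      h * (\<Sum>k<n. (of_real (real k / real n) powr v - 1) / (of_real (real k / real n) - 1))
      - ((Digamma (v + 1) + euler_mascheroni)
         + (\<Sum>j=1..N. bern_coeff j * h ^ j * (falling_fact v j * (1 / of_nat j) - fact (j - 1))))) {0..1}"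
    unfolding \<phi>_def[abs_def] using v
    by (intro has_integral_diff has_integral_add has_integral_sum has_integral_mult_right
        powr_diff_quotient_has_integral digamma_has_integral beta_has_integral power_has_integral) auto
  have \<phi>_bound: "norm (\<phi> t) \<le> bern_abs_sum N * norm (falling_fact v (Suc N)) / real n ^ N"
    if t: "t \<in> {0..1} - {0, 1}" for t
  proof -
    have seg: "\<exists>x. 0 \<le> x \<and> x \<le> 1 \<and> z = complex_of_real x" if z: "z \<in> closed_segment 0 (0 + of_nat n * h)" for z
      using z unfolding nh by (auto simp: closed_segment_def scaleR_conv_of_real)
    have base: "1 - t + t * x > 0" "1 - t + t * x \<le> 1" if "0 \<le> x" "x \<le> 1" for x
      using segment_pos[of t x] t that mult_left_mono[of x 1 t] by auto
    have "norm (h * (\<Sum>k<n. f t 1 (0 + of_nat k * h))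
            - (\<Sum>j\<le>N. bern_coeff j * h ^ j * (f t j (0 + of_nat n * h) - f t j 0)))
        \<le> of_nat n * (bern_abs_sum N * norm (falling_fact v (Suc N)) * norm h ^ Suc N)"
    proof (rule euler_maclaurin_sum[OF N])
      fix j z assume "z \<in> closed_segment 0 (0 + of_nat n * h)"
      then obtain x where x: "0 \<le> x" "x \<le> 1" "z = complex_of_real x" using seg by blast
      have "((\<lambda>z. c * (1 - of_real t + of_real t * z) powr (v - of_nat j)) has_field_derivative
          c * ((v - of_nat j) * of_real t) * (1 - of_real t + of_real t * z) powr (v - of_nat (Suc j))) (at z)" for c
        using base[OF x(1,2)] x(3)
        by (auto intro!: derivative_eq_intros simp: complex_nonpos_Reals_iff algebra_simps)
      moreover have "falling_fact v (Suc j) * (of_real t ^ Suc j / of_real t)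
          = falling_fact v j * (of_real t ^ j / of_real t) * ((v - of_nat j) * of_real t)"
        by (simp add: falling_fact_Suc)
      ultimately show "(f t j has_field_derivative f t (Suc j) z) (at z)"
        unfolding f_def by metis
    next
      fix z assume "z \<in> closed_segment 0 (0 + of_nat n * h)"
      then obtain x where x: "0 \<le> x" "x \<le> 1" "z = complex_of_real x" using seg by blast
      have eq: "1 - of_real t + of_real t * z = complex_of_real (1 - t + t * x)" by (simp add: x)
      have "norm (f t (Suc N) z) = norm (falling_fact v (Suc N)) * (t ^ N * (1 - t + t * x) powr (Re v - (N + 1)))"
        using t base[OF x(1,2)] unfolding f_def eq
        by (simp add: norm_mult norm_power norm_powr_real_powr)
      also have "\<dots> \<le> norm (falling_fact v (Suc N)) * (1 * 1)"
        using t base[OF x(1,2)] v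
        by (intro mult_left_mono mult_mono power_le_one powr_le1) auto
      finally show "norm (f t (Suc N) z) \<le> norm (falling_fact v (Suc N))" by simp
    qed
    moreover have "real n * (bern_abs_sum N * norm (falling_fact v (Suc N)) * norm h ^ Suc N)
        = bern_abs_sum N * norm (falling_fact v (Suc N)) / real n ^ N"
      using n by (simp add: h_def norm_divide power_divide)
    moreover have "h * (\<Sum>k<n. f t 1 (0 + of_nat k * h))
            - (\<Sum>j\<le>N. bern_coeff j * h ^ j * (f t j (0 + of_nat n * h) - f t j 0)) = \<phi> t"
    proof -
      have "(\<Sum>k<n. f t 1 (0 + of_nat k * h)) = (\<Sum>k<n. v * complex_of_real (1 - t + t * (real k / real n)) powr (v - 1))"
        using t by (intro sum.cong) (auto simp: f_def falling_fact_def h_def)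
      moreover have "(\<Sum>j\<le>N. bern_coeff j * h ^ j * (f t j (0 + of_nat n * h) - f t j 0))
          = bern_coeff 0 * h ^ 0 * (f t 0 1 - f t 0 0) + (\<Sum>j=1..N. bern_coeff j * h ^ j * (f t j 1 - f t j 0))"
        unfolding nh atLeast0AtMost[symmetric] by (subst sum.atLeast_Suc_atMost) auto
      moreover have "f t 0 1 - f t 0 0 = (1 - complex_of_real (1 - t) powr v) / of_real t"
        by (simp add: f_def diff_divide_distrib)
      moreover have "f t j 1 - f t j 0 = falling_fact v j * of_real t ^ (j - 1)
              - falling_fact v j * of_real t ^ (j - 1) * complex_of_real (1 - t) powr (v - of_nat j)" if "j \<ge> 1" for j
        using that t by (cases j) (auto simp: f_def)
      ultimately show ?thesis by (simp add: \<phi>_def)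
    qed
    ultimately show ?thesis by simp
  qed
  have "(\<Sum>k<n. h * ((of_real (real k / real n) powr v - 1) / (of_real (real k / real n) - 1)))
      = (\<Sum>k<n. 1 / of_nat (n - k) - (of_nat k / of_nat n) powr v / of_nat (n - k))"
  proof (intro sum.cong refl)
    fix k assume "k \<in> {..<n}"
    then have k: "k < n" by simp
    have "complex_of_nat n - of_nat k \<noteq> 0" using k by auto
    then show "h * ((of_real (real k / real n) powr v - 1) / (of_real (real k / real n) - 1))
        = 1 / of_nat (n - k) - (of_nat k / of_nat n) powr v / of_nat (n - k)"
      using k by (simp add: h_def of_nat_diff divide_simps) (simp add: algebra_simps)
  qed
  also have "\<dots> = (\<Sum>k<n. 1 / of_nat (n - k)) - (\<Sum>k<n. (of_nat k / of_nat n) powr v / of_nat (n - k))"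
    by (simp add: sum_subtractf)
  also have "(\<Sum>k<n. 1 / of_nat (n - k)) = (harm n :: complex)"
    unfolding harm_def by (rule sum.reindex_bij_witness[of _ "\<lambda>k. n - k" "\<lambda>k. n - k"]) (auto simp: inverse_eq_divide)
  also have "(\<Sum>k<n. (of_nat k / of_nat n) powr v / of_nat (n - k) :: complex)
      = (\<Sum>k=1..<n. (of_nat k / of_nat n) powr v / of_nat (n - k))"
    by (rule sum.mono_neutral_right) (auto simp: not_le)
  finally have E_eq: "?E = h * (\<Sum>k<n. (of_real (real k / real n) powr v - 1) / (of_real (real k / real n) - 1))
      - ((Digamma (v + 1) + euler_mascheroni)
         + (\<Sum>j=1..N. bern_coeff j * h ^ j * (falling_fact v j * (1 / of_nat j) - fact (j - 1))))"
    by (simp add: sum_distrib_left h_def power_one_over)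
  have "(\<phi> has_integral ?E) (cbox 0 1)"
    unfolding E_eq box_real by (rule \<phi>_int)
  then have "norm ?E \<le> bern_abs_sum N * norm (falling_fact v (Suc N)) / real n ^ N * measure lborel (cbox 0 (1::real))"
    using \<phi>_bound bern_abs_sum_ge_0[of N]
    by (intro has_integral_bound_spike_finite[of _ "{0, 1}" \<phi>]) auto
  then show ?thesis by simp
qed


section \<open>Bounds that are uniform in the exponent\<close>

text \<open>
  The closed disc of radius $1/2$ avoids the negative integers, where $\psi(1+u)$ and
  $\zeta(1-k-u)$ have poles, and Cauchy's inequality can be used on it.
\<close>
definition unif_bigo :: "real \<Rightarrow> (nat \<Rightarrow> complex \<Rightarrow> complex) \<Rightarrow> bool" where
  "unif_bigo a E \<longleftrightarrow> (\<exists>C. \<forall>n\<ge>1. \<forall>u\<in>cball 0 (1/2). norm (E n u) \<le> C * real n powr a)"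

lemma unif_bigoI:
  assumes "\<And>n u. n \<ge> 1 \<Longrightarrow> norm u \<le> 1/2 \<Longrightarrow> norm (E n u) \<le> C * real n powr a"
  shows "unif_bigo a E"
  unfolding unif_bigo_def by (intro exI[of _ C]) (auto intro: assms)

lemma unif_bigoE:
  assumes "unif_bigo a E"
  obtains C where "C \<ge> 0"
    "\<And>n u. n \<ge> 1 \<Longrightarrow> norm u \<le> 1/2 \<Longrightarrow> norm (E n u) \<le> C * real n powr a"
proof -
  obtain C where C: "\<forall>n\<ge>1. \<forall>u\<in>cball 0 (1/2). norm (E n u) \<le> C * real n powr a"
    using assms unfolding unif_bigo_def by blast
  then have "norm (E 1 0) \<le> C" by force
  then have "C \<ge> 0" using norm_ge_zero order_trans by blast
  then show thesis using C by (intro that) auto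
qed

lemma unif_bigo_mono:
  assumes "unif_bigo a E" "a \<le> b"
  shows "unif_bigo b E"
proof -
  obtain C where C: "C \<ge> 0" "\<And>n u. n \<ge> 1 \<Longrightarrow> norm u \<le> 1/2 \<Longrightarrow> norm (E n u) \<le> C * real n powr a"
    using unif_bigoE[OF assms(1)] by blast
  show ?thesis
  proof (rule unif_bigoI)
    fix n :: nat and u :: complex assume *: "n \<ge> 1" "norm u \<le> 1/2"
    show "norm (E n u) \<le> C * real n powr b"
      using C(2)[OF *] mult_left_mono[OF powr_mono[OF assms(2)] C(1), of "real n"] * by simp
  qed
qed

lemma unif_bigo_add:
  assumes "unif_bigo a E" "unif_bigo a F"
  shows "unif_bigo a (\<lambda>n u. E n u + F n u)"
proof -
  obtain C where C: "C \<ge> 0" "\<And>n u. n \<ge> 1 \<Longrightarrow> norm u \<le> 1/2 \<Longrightarrow> norm (E n u) \<le> C * real n powr a"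
    using unif_bigoE[OF assms(1)] by blast
  obtain D where D: "D \<ge> 0" "\<And>n u. n \<ge> 1 \<Longrightarrow> norm u \<le> 1/2 \<Longrightarrow> norm (F n u) \<le> D * real n powr a"
    using unif_bigoE[OF assms(2)] by blast
  show ?thesis
  proof (rule unif_bigoI)
    fix n :: nat and u :: complex assume *: "n \<ge> 1" "norm u \<le> 1/2"
    show "norm (E n u + F n u) \<le> (C + D) * real n powr a"
      using norm_triangle_ineq[of "E n u" "F n u"] C(2)[OF *] D(2)[OF *] by (simp add: algebra_simps)
  qed
qed

lemma unif_bigo_uminus: "unif_bigo a E \<Longrightarrow> unif_bigo a (\<lambda>n u. - E n u)"
  by (simp add: unif_bigo_def)

lemma unif_bigo_diff:
  assumes "unif_bigo a E" "unif_bigo a F"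
  shows "unif_bigo a (\<lambda>n u. E n u - F n u)"
  using unif_bigo_add[OF assms(1) unif_bigo_uminus[OF assms(2)]] by simp

lemma unif_bigo_sum:
  assumes "\<And>i. i \<in> A \<Longrightarrow> unif_bigo a (E i)"
  shows "unif_bigo a (\<lambda>n u. \<Sum>i\<in>A. E i n u)"
proof (cases "finite A")
  case True
  then show ?thesis using assms
    by (induction A rule: finite_induct) (auto intro!: unif_bigo_add intro: unif_bigoI[where C = 0])
qed (auto intro!: unif_bigoI[where C = 0])

lemma unif_bigo_mult:
  assumes "unif_bigo a E" "unif_bigo b F"
  shows "unif_bigo (a + b) (\<lambda>n u. E n u * F n u)"
proof -
  obtain C where C: "C \<ge> 0" "\<And>n u. n \<ge> 1 \<Longrightarrow> norm u \<le> 1/2 \<Longrightarrow> norm (E n u) \<le> C * real n powr a"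
    using unif_bigoE[OF assms(1)] by blast
  obtain D where D: "D \<ge> 0" "\<And>n u. n \<ge> 1 \<Longrightarrow> norm u \<le> 1/2 \<Longrightarrow> norm (F n u) \<le> D * real n powr b"
    using unif_bigoE[OF assms(2)] by blast
  show ?thesis
  proof (rule unif_bigoI)
    fix n :: nat and u :: complex assume *: "n \<ge> 1" "norm u \<le> 1/2"
    have "norm (E n u * F n u) \<le> (C * real n powr a) * (D * real n powr b)"
      unfolding norm_mult using C D * by (intro mult_mono) auto
    then show "norm (E n u * F n u) \<le> (C * D) * real n powr (a + b)"
      by (simp add: powr_add mult_ac)
  qed
qed

lemma unif_bigo_continuous:
  assumes "continuous_on (cball 0 (1/2)) g"
  shows "unif_bigo 0 (\<lambda>n. g)"
proof -
  have "bounded (g ` cball 0 (1/2))"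
    by (intro compact_imp_bounded compact_continuous_image assms) auto
  then obtain B where "\<forall>y\<in>g ` cball 0 (1/2). norm y \<le> B"
    unfolding bounded_iff by (elim exE)
  then show ?thesis by (intro unif_bigoI[where C = B]) auto
qed

lemma unif_bigo_inverse_power: "unif_bigo (- real j) (\<lambda>n u. 1 / of_nat n ^ j)"
  by (rule unif_bigoI[where C = 1]) (simp add: norm_divide norm_power powr_minus_divide powr_realpow)

lemma unif_bigo_powr: "unif_bigo (1/2) (\<lambda>n u. of_nat n powr u)"
proof (rule unif_bigoI)
  fix n :: nat and u :: complex assume *: "n \<ge> 1" "norm u \<le> 1/2"
  then have "Re u \<le> 1/2" using complex_Re_le_cmod[of u] by linarith
  then show "norm (of_nat n powr u :: complex) \<le> 1 * real n powr (1/2)"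
    using * by (auto simp: norm_powr_real_powr intro!: powr_mono)
qed

lemma continuous_on_falling_fact [continuous_intros]:
  "continuous_on A f \<Longrightarrow> continuous_on A (\<lambda>z. falling_fact (f z) j)"
  unfolding falling_fact_def by (intro continuous_intros)

section \<open>The uniform expansion\<close>

text \<open>
  The discrete analogue of $\int x^j\,dx = x^{j+1}/(j+1)$.
\<close>
lemma falling_fact_telescope:
  "(\<Sum>i<L. falling_fact (u + of_nat i) j) = (falling_fact (u + of_nat L) (Suc j) - falling_fact u (Suc j)) / of_nat (Suc j)"
proof (induction L)
  case (Suc L)
  have "falling_fact (u + of_nat (Suc L)) (Suc j) - falling_fact (u + of_nat L) (Suc j)
      = of_nat (Suc j) * falling_fact (u + of_nat L) j"
    using falling_fact_Suc_shift[of "u + of_nat (Suc L)" j] falling_fact_Suc[of "u + of_nat L" j]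
    by (simp add: algebra_simps)
  then have "falling_fact (u + of_nat L) j = (falling_fact (u + of_nat (Suc L)) (Suc j) - falling_fact (u + of_nat L) (Suc j)) / of_nat (Suc j)"
    by (simp del: of_nat_Suc)
  then show ?case using Suc by (simp add: diff_divide_distrib del: of_nat_Suc)
qed simp

definition power_conv :: "nat \<Rightarrow> complex \<Rightarrow> complex" where
  "power_conv n u = (\<Sum>k=1..<n. of_nat k powr u / of_nat (n - k))"

text \<open>
  The geometric sum $\sum_{i<L} r^i = (1-r^L)/(1-r)$ for $r = k/n$.
\<close>
lemma power_conv_split:
  assumes n: "n \<ge> 1"
  shows "power_conv n u = (\<Sum>i<L. (1 / of_nat n ^ Suc i) * (\<Sum>k=1..<n. of_nat k powr (u + of_nat i)))
     + of_nat n powr u * (\<Sum>k=1..<n. (of_nat k / of_nat n) powr (u + of_nat L) / of_nat (n - k))"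
proof -
  have "of_nat k powr u / of_nat (n - k)
      = (\<Sum>i<L. (1 / of_nat n ^ Suc i) * of_nat k powr (u + of_nat i))
        + of_nat n powr u * ((of_nat k / of_nat n) powr (u + of_nat L) / of_nat (n - k))"
    if k: "k \<in> {1..<n}" for k
  proof -
    define r where "r = complex_of_nat k / of_nat n"
    have nz: "complex_of_nat n - of_nat k \<noteq> 0" "complex_of_nat n \<noteq> 0" using k by auto
    have r1: "r \<noteq> 1" "r \<noteq> 0" using k by (auto simp: r_def)
    have "of_nat n * r = of_nat k" using nz by (simp add: r_def)
    then have split: "of_nat k powr u = of_nat n powr u * r powr u"
      using powr_times_real[of "of_nat n" r u] by (auto simp: r_def)
    have summand: "(1 / of_nat n ^ Suc i) * of_nat k powr (u + of_nat i) = of_nat k powr u / of_nat n * r ^ i" for i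
      using k by (simp add: powr_add powr_nat' r_def power_divide)
    have "(\<Sum>i<L. (1 / of_nat n ^ Suc i) * of_nat k powr (u + of_nat i)) = of_nat k powr u / of_nat n * ((1 - r ^ L) / (1 - r))"
      unfolding summand sum_distrib_left[symmetric] using r1 by (simp add: sum_gp_strict)
    also have "\<dots> = of_nat k powr u * (1 - r ^ L) / (of_nat n * (1 - r))"
      by simp
    also have "of_nat n * (1 - r) = of_nat (n - k)"
      using k nz by (simp add: r_def of_nat_diff right_diff_distrib)
    finally have 1: "(\<Sum>i<L. (1 / of_nat n ^ Suc i) * of_nat k powr (u + of_nat i))
        = of_nat k powr u * (1 - r ^ L) / of_nat (n - k)" .
    have 2: "of_nat n powr u * (r powr (u + of_nat L) / of_nat (n - k)) = of_nat k powr u * r ^ L / of_nat (n - k)"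
      using r1 by (simp add: split powr_add powr_nat')
    show ?thesis
      unfolding 1 r_def[symmetric] 2 by (simp add: add_divide_distrib[symmetric] algebra_simps)
  qed
  then have "power_conv n u = (\<Sum>k=1..<n. (\<Sum>i<L. (1 / of_nat n ^ Suc i) * of_nat k powr (u + of_nat i))
        + of_nat n powr u * ((of_nat k / of_nat n) powr (u + of_nat L) / of_nat (n - k)))"
    unfolding power_conv_def by (intro sum.cong) auto
  then show ?thesis
    by (simp add: sum.distrib sum_distrib_left sum.swap[of _ "{..<L}"])
qed


text \<open>
  The part of the expansion that is multiplied by $n^u$: the regularised integral over $[0,n]$ and
  the contributions of the end $k = n$.
\<close>
definition conv_main :: "nat \<Rightarrow> nat \<Rightarrow> complex \<Rightarrow> complex" where
  "conv_main M n u = of_real (ln (real n)) - Digamma (u + 1)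
     - (\<Sum>j=1..M. complex_of_real (bern_coeff j) / of_nat n ^ j * (falling_fact u j / of_nat j))"

text \<open>
  The contributions of the end $k = 0$.
\<close>
definition conv_zeta :: "nat \<Rightarrow> nat \<Rightarrow> complex \<Rightarrow> complex" where
  "conv_zeta M n u = (\<Sum>k=1..M. zeta (1 - of_nat k - u) / of_nat n ^ k)"

lemma holomorphic_zeta_shift:
  assumes "k \<ge> 1"
  shows "(\<lambda>u. zeta (1 - of_nat k - u)) holomorphic_on ball 0 1"
proof -
  have "1 - of_nat k - u \<noteq> 1" if u: "norm u < 1" for u :: complex
  proof
    assume "1 - of_nat k - u = 1"
    then have "u = - of_nat k" by (simp add: algebra_simps eq_neg_iff_add_eq_0)
    then have "norm u = real k" by simp
    then show False using u assms by simp
  qed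
  then have "(\<lambda>u. 1 - of_nat k - u) ` ball 0 1 \<subseteq> - {1 :: complex}"
    by (intro image_subsetI) (simp only: mem_ball_0 Compl_iff singleton_iff not_False_eq_True)
  then have "zeta \<circ> (\<lambda>u. 1 - of_nat k - u) holomorphic_on ball 0 1"
    by (intro holomorphic_on_compose_gen[OF _ holomorphic_zeta] holomorphic_intros)
  then show ?thesis by (simp add: o_def)
qed

lemma continuous_on_zeta_shift:
  "k \<ge> 1 \<Longrightarrow> continuous_on (cball 0 (1/2)) (\<lambda>u. zeta (1 - of_nat k - u))"
  by (rule holomorphic_on_imp_continuous_on[OF holomorphic_on_subset[OF holomorphic_zeta_shift]]) auto

text \<open>
  After splitting off $L$ geometric terms, the power sums and the weighted sum are replaced by their
  expansions. The quantities depending on $L$ disappear: the sums $\sum_{i<L} 1/(u+i+1)$ by the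
  functional equation of the Digamma function, the falling factorials of $u+L$ by telescoping.
\<close>
lemma power_conv_asymp:
  "unif_bigo (- real M - 1/2)
     (\<lambda>n u. power_conv n u - (of_nat n powr u * conv_main M n u + conv_zeta M n u))"
proof -
  \<comment> \<open>The weighted sum is expanded to order N; this loses n^(1/2) through the factor n^u, so one term
      more than M is taken. It requires N + 1 <= Re (u + L). The power sums have exponents up to
      Re w <= L + 1/2, and their expansion of length P requires Re w < P - 1.\<close>
  define N where "N = Suc M"
  define L where "L = M + 3"
  define P where "P = M + 5"
  define b where "b j n = complex_of_real (bern_coeff j) / of_nat n ^ j" for j n
  define w where "w i u = u + of_nat i + 1" for i :: nat and u :: complex
  define eZ where "eZ i n u = w i u * (\<Sum>k=1..<n. of_nat k powr (w i u - 1)) - power_sum_expansion P (w i u) n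
      - w i u * zeta (1 - w i u)" for i n u
  define eH where "eH n = (harm n - (ln (real n) + euler_mascheroni)
               + (\<Sum>j=1..N. complex_of_real (bern_coeff j) * fact (j - 1) / of_nat n ^ j) :: complex)" for n
  define eR where "eR n u = (harm n - (\<Sum>k=1..<n. (of_nat k / of_nat n) powr (u + of_nat L) / of_nat (n - k))
                 - (Digamma (u + of_nat L + 1) + euler_mascheroni)
                 - (\<Sum>j=1..N. complex_of_real (bern_coeff j) / of_nat n ^ j * (falling_fact (u + of_nat L) j / of_nat j - fact (j - 1))))" for n u

  have Re_bound: "\<bar>Re u\<bar> \<le> 1/2" if "norm u \<le> 1/2" for u
    using abs_Re_le_cmod[of u] that by linarith
  have w_nz: "w i u \<noteq> 0" "norm (w i u) \<ge> 1/2" if "norm u \<le> 1/2" for i u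
  proof -
    have "Re (w i u) \<ge> 1/2" using Re_bound[OF that] by (simp add: w_def)
    then show "norm (w i u) \<ge> 1/2" using complex_Re_le_cmod[of "w i u"] by linarith
    then show "w i u \<noteq> 0" by auto
  qed
  have cont_w: "continuous_on A (w i)" for i A
    unfolding w_def by (intro continuous_intros)

  have eZ: "unif_bigo (- real M - 1/2) (\<lambda>n u. 1 / of_nat n ^ Suc i * (eZ i n u / w i u))" if i: "i < L" for i
  proof -
    obtain C where C: "C \<ge> 0" "\<And>n u. n \<ge> 1 \<Longrightarrow> norm u \<le> 1/2 \<Longrightarrow> norm (falling_fact (w i u) (Suc P)) \<le> C * real n powr 0"
      using unif_bigoE[OF unif_bigo_continuous[OF continuous_on_falling_fact[OF cont_w]]] by blast
    show ?thesis
    proof (rule unif_bigoI)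
      fix n :: nat and u :: complex assume *: "n \<ge> 1" "norm u \<le> 1/2"
      have "norm (eZ i n u) \<le> 2 * (bern_abs_sum P * norm (falling_fact (w i u) (Suc P))) * real n powr (Re (w i u) - P)"
        unfolding eZ_def using * w_nz[of u i] i Re_bound[of u]
        by (intro power_sum_asymp) (auto simp: P_def L_def w_def)
      also have "\<dots> \<le> 2 * (bern_abs_sum P * C) * real n powr (real (Suc i) + (- real M - 1/2))"
        using C(2)[OF *] C(1) * bern_abs_sum_ge_0[of P] Re_bound[of u]
        by (intro mult_mono powr_mono) (auto simp: P_def w_def)
      also have "\<dots> = 2 * (bern_abs_sum P * C) * (real n ^ Suc i * real n powr (- real M - 1/2))"
        using * powr_realpow[of "real n" "Suc i"] by (simp only: powr_add of_nat_0_less_iff)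
      finally have "norm (eZ i n u) / (real n ^ Suc i * norm (w i u))
          \<le> 2 * (bern_abs_sum P * C) * (real n ^ Suc i * real n powr (- real M - 1/2)) / (real n ^ Suc i * norm (w i u))"
        by (intro divide_right_mono) auto
      also have "\<dots> = 2 * (bern_abs_sum P * C) * real n powr (- real M - 1/2) / norm (w i u)"
        using * by simp
      also have "\<dots> \<le> 2 * (bern_abs_sum P * C) * real n powr (- real M - 1/2) / (1/2)"
        using w_nz[OF *(2), of i] C(1) bern_abs_sum_ge_0[of P] by (intro divide_left_mono) auto
      finally show "norm (1 / of_nat n ^ Suc i * (eZ i n u / w i u)) \<le> 4 * (bern_abs_sum P * C) * real n powr (- real M - 1/2)"
        by (simp add: norm_mult norm_divide norm_power)
    qed
  qed

  have eH: "unif_bigo (- real N) (\<lambda>n u. eH n)"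
  proof (rule unif_bigoI)
    fix n :: nat assume n: "n \<ge> 1"
    then have pow: "real n powr (- real N) = 1 / real n ^ N"
      by (simp add: powr_minus_divide powr_realpow)
    have "N \<ge> 1" by (simp add: N_def)
    then show "norm (eH n) \<le> 2 * (bern_abs_sum N * fact N) * real n powr (- real N)"
      using harm_asymp[of N n] n unfolding eH_def pow by simp
  qed
  have eR: "unif_bigo (- real N) eR"
  proof -
    obtain C where C: "C \<ge> 0" "\<And>n u. n \<ge> 1 \<Longrightarrow> norm u \<le> 1/2 \<Longrightarrow> norm (falling_fact (u + of_nat L) (Suc N)) \<le> C * real n powr 0"
    proof (rule unif_bigoE[OF unif_bigo_continuous[of "\<lambda>u. falling_fact (u + of_nat L) (Suc N)"]])
      show "continuous_on (cball 0 (1/2)) (\<lambda>u. falling_fact (u + of_nat L) (Suc N))"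
        by (intro continuous_intros)
    qed blast
    show ?thesis
    proof (rule unif_bigoI)
      fix n :: nat and u :: complex assume *: "n \<ge> 1" "norm u \<le> 1/2"
      have "norm (eR n u) \<le> bern_abs_sum N * norm (falling_fact (u + of_nat L) (Suc N)) / real n ^ N"
        unfolding eR_def using * Re_bound[of u]
        by (intro weighted_power_sum_asymp) (auto simp: N_def L_def)
      also have "\<dots> \<le> bern_abs_sum N * C / real n ^ N"
        using C(2)[OF *] * bern_abs_sum_ge_0[of N] by (intro divide_right_mono mult_left_mono) auto
      also have "\<dots> = bern_abs_sum N * C * real n powr (- real N)"
        using * by (simp add: powr_minus_divide powr_realpow)
      finally show "norm (eR n u) \<le> bern_abs_sum N * C * real n powr (- real N)" .
    qed
  qed

  define t where "t j n u = b j n * (falling_fact u j / of_nat j)" for j n u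
  have t_O: "unif_bigo (- real N) (\<lambda>n u. t j n (f u))" if "j > M" "continuous_on (cball 0 (1/2)) f" for j f
  proof -
    have "unif_bigo (- real j + 0) (\<lambda>n u. 1 / of_nat n ^ j * (bern_coeff j * (falling_fact (f u) j / of_nat j)))"
      using that by (intro unif_bigo_mult unif_bigo_inverse_power unif_bigo_continuous continuous_intros) auto
    then have "unif_bigo (- real N) (\<lambda>n u. 1 / of_nat n ^ j * (bern_coeff j * (falling_fact (f u) j / of_nat j)))"
      by (rule unif_bigo_mono) (use that in \<open>simp add: N_def\<close>)
    then show ?thesis by (simp add: t_def b_def)
  qed

  define rest where "rest n u = of_nat n powr u * ((\<Sum>j=Suc N..P. t j n (u + of_nat L)) - (\<Sum>j=Suc M..P. t j n u) + eH n - eR n u)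
      + (\<Sum>k=Suc M..L. zeta (1 - of_nat k - u) / of_nat n ^ k)
      + (\<Sum>i<L. 1 / of_nat n ^ Suc i * (eZ i n u / w i u))" for n u
  have "unif_bigo (- real M - 1/2) rest"
    unfolding rest_def
  proof (intro unif_bigo_add)
    have "unif_bigo (1/2 + - real N) (\<lambda>n u. of_nat n powr u * ((\<Sum>j=Suc N..P. t j n (u + of_nat L)) - (\<Sum>j=Suc M..P. t j n u) + eH n - eR n u))"
      by (intro unif_bigo_mult unif_bigo_powr unif_bigo_add unif_bigo_diff unif_bigo_sum t_O eH eR continuous_intros) (auto simp: N_def)
    moreover have "1/2 + - real N = - real M - 1/2" by (simp add: N_def)
    ultimately show "unif_bigo (- real M - 1/2) (\<lambda>n u. of_nat n powr u * ((\<Sum>j=Suc N..P. t j n (u + of_nat L)) - (\<Sum>j=Suc M..P. t j n u) + eH n - eR n u))"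
      by (simp only:)
    show "unif_bigo (- real M - 1/2) (\<lambda>n u. \<Sum>k=Suc M..L. zeta (1 - of_nat k - u) / of_nat n ^ k)"
    proof (rule unif_bigo_sum)
      fix k assume k: "k \<in> {Suc M..L}"
      have "unif_bigo (- real k + 0) (\<lambda>n u. 1 / of_nat n ^ k * zeta (1 - of_nat k - u))"
        using k by (intro unif_bigo_mult unif_bigo_inverse_power unif_bigo_continuous continuous_on_zeta_shift) auto
      then have "unif_bigo (- real M - 1/2) (\<lambda>n u. 1 / of_nat n ^ k * zeta (1 - of_nat k - u))"
        by (rule unif_bigo_mono) (use k in auto)
      then show "unif_bigo (- real M - 1/2) (\<lambda>n u. zeta (1 - of_nat k - u) / of_nat n ^ k)" by simp
    qed
    show "unif_bigo (- real M - 1/2) (\<lambda>n u. \<Sum>i<L. 1 / of_nat n ^ Suc i * (eZ i n u / w i u))"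
      by (intro unif_bigo_sum eZ) auto
  qed
  moreover have "power_conv n u - (of_nat n powr u * conv_main M n u + conv_zeta M n u) = rest n u"
    if *: "n \<ge> 1" "norm u \<le> 1/2" for n u
  proof -
    have n0: "complex_of_nat n \<noteq> 0" using * by simp
    have term_i: "(1 / of_nat n ^ Suc i) * (\<Sum>k=1..<n. of_nat k powr (u + of_nat i))
        = zeta (1 - of_nat (Suc i) - u) / of_nat n ^ Suc i
          + of_nat n powr u * (1 / w i u + (\<Sum>j=1..P. b j n * falling_fact (u + of_nat i) (j - 1)))
          + 1 / of_nat n ^ Suc i * (eZ i n u / w i u)" for i
    proof -
      note wnz = w_nz(1)[OF *(2), of i]
      have "(\<Sum>k=1..<n. of_nat k powr (w i u - 1))
          = zeta (1 - w i u) + power_sum_expansion P (w i u) n / w i u + eZ i n u / w i u"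
        using wnz by (simp add: eZ_def field_simps)
      moreover have "1 / of_nat n ^ Suc i * (power_sum_expansion P (w i u) n / w i u)
          = of_nat n powr u * (1 / w i u + (\<Sum>j=1..P. b j n * falling_fact (u + of_nat i) (j - 1)))"
      proof -
        have "1 / of_nat n ^ Suc i * (bern_coeff j * falling_fact (w i u) j * of_nat n powr (w i u - of_nat j) / w i u)
            = of_nat n powr u * (b j n * (falling_fact (w i u) j / w i u))" for j
        proof -
          have "of_nat n powr (w i u - of_nat j) = of_nat n powr u * of_nat n ^ Suc i / of_nat n ^ j"
            using n0 by (simp add: w_def powr_diff powr_add powr_nat' mult_ac)
          then show ?thesis using n0 by (simp add: b_def)
        qed
        then have "1 / of_nat n ^ Suc i * (power_sum_expansion P (w i u) n / w i u)
            = of_nat n powr u * (\<Sum>j\<le>P. b j n * (falling_fact (w i u) j / w i u))"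
          unfolding power_sum_expansion_def sum_divide_distrib sum_distrib_left by (intro sum.cong) auto
        also have "(\<Sum>j\<le>P. b j n * (falling_fact (w i u) j / w i u))
            = b 0 n * (falling_fact (w i u) 0 / w i u) + (\<Sum>j=1..P. b j n * (falling_fact (w i u) j / w i u))"
          unfolding atLeast0AtMost[symmetric] by (subst sum.atLeast_Suc_atMost) auto
        also have "(\<Sum>j=1..P. b j n * (falling_fact (w i u) j / w i u)) = (\<Sum>j=1..P. b j n * falling_fact (u + of_nat i) (j - 1))"
        proof (intro sum.cong refl)
          fix j assume "j \<in> {1..P}"
          then obtain j' where j': "j = Suc j'" by (cases j) auto
          show "b j n * (falling_fact (w i u) j / w i u) = b j n * falling_fact (u + of_nat i) (j - 1)"
            using wnz unfolding j' falling_fact_Suc_shift by (simp add: w_def)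
        qed
        also have "b 0 n * (falling_fact (w i u) 0 / w i u) = 1 / w i u" by (simp add: b_def)
        finally show ?thesis .
      qed
      moreover have "1 - w i u = 1 - of_nat (Suc i) - u" "w i u - 1 = u + of_nat i" by (simp_all add: w_def)
      ultimately show ?thesis by (simp add: distrib_left)
    qed
    have A: "(\<Sum>i<L. (1 / of_nat n ^ Suc i) * (\<Sum>k=1..<n. of_nat k powr (u + of_nat i)))
        = conv_zeta M n u + (\<Sum>k=Suc M..L. zeta (1 - of_nat k - u) / of_nat n ^ k)
          + of_nat n powr u * ((\<Sum>i<L. 1 / w i u) + (\<Sum>j=1..P. t j n (u + of_nat L)) - (\<Sum>j=1..P. t j n u))
          + (\<Sum>i<L. 1 / of_nat n ^ Suc i * (eZ i n u / w i u))"
    proof -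
      have "(\<Sum>i<L. zeta (1 - of_nat (Suc i) - u) / of_nat n ^ Suc i) = (\<Sum>k=1..L. zeta (1 - of_nat k - u) / of_nat n ^ k)"
        by (rule sum.reindex_bij_witness[of _ "\<lambda>k. k - 1" Suc]) auto
      also have "\<dots> = conv_zeta M n u + (\<Sum>k=Suc M..L. zeta (1 - of_nat k - u) / of_nat n ^ k)"
        using sum.ub_add_nat[of 1 M "\<lambda>k. zeta (1 - of_nat k - u) / of_nat n ^ k" 3]
        by (simp add: conv_zeta_def L_def)
      finally have 1: "(\<Sum>i<L. zeta (1 - of_nat (Suc i) - u) / of_nat n ^ Suc i)
          = conv_zeta M n u + (\<Sum>k=Suc M..L. zeta (1 - of_nat k - u) / of_nat n ^ k)" .
      have "(\<Sum>i<L. \<Sum>j=1..P. b j n * falling_fact (u + of_nat i) (j - 1))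
          = (\<Sum>j=1..P. b j n * (\<Sum>i<L. falling_fact (u + of_nat i) (j - 1)))"
        by (subst sum.swap) (simp add: sum_distrib_left)
      also have "\<dots> = (\<Sum>j=1..P. t j n (u + of_nat L) - t j n u)"
        unfolding falling_fact_telescope by (intro sum.cong) (auto simp: t_def diff_divide_distrib right_diff_distrib)
      finally have 2: "(\<Sum>i<L. \<Sum>j=1..P. b j n * falling_fact (u + of_nat i) (j - 1))
          = (\<Sum>j=1..P. t j n (u + of_nat L)) - (\<Sum>j=1..P. t j n u)" by (simp add: sum_subtractf)
      show ?thesis
        unfolding term_i sum.distrib sum_distrib_left[symmetric] 1 2 by simp
    qed
    have B: "(\<Sum>k=1..<n. (of_nat k / of_nat n) powr (u + of_nat L) / of_nat (n - k))
        = of_real (ln (real n)) - Digamma (u + 1) - (\<Sum>i<L. 1 / w i u) - (\<Sum>j=1..N. t j n (u + of_nat L)) + eH n - eR n u"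
    proof -
      have "u + 1 \<noteq> - of_nat k" for k
        using Re_bound[OF *(2)] by (auto simp: complex_eq_iff)
      then have "Digamma (u + 1 + of_nat L) = Digamma (u + 1) + (\<Sum>i<L. 1 / w i u)"
        by (subst Polygamma_plus_of_nat) (auto simp: w_def add_ac)
      then have D: "Digamma (u + of_nat L + 1) = Digamma (u + 1) + (\<Sum>i<L. 1 / w i u)"
        by (simp add: add_ac)
      have T: "(\<Sum>j=1..N. complex_of_real (bern_coeff j) / of_nat n ^ j * (falling_fact (u + of_nat L) j / of_nat j - fact (j - 1)))
          = (\<Sum>j=1..N. t j n (u + of_nat L)) - (\<Sum>j=1..N. complex_of_real (bern_coeff j) * fact (j - 1) / of_nat n ^ j)"
        by (simp add: t_def b_def right_diff_distrib sum_subtractf)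
      show ?thesis unfolding eH_def eR_def D T by (simp add: algebra_simps of_real_harm)
    qed
    have split1: "(\<Sum>j=1..P. t j n (u + of_nat L)) = (\<Sum>j=1..N. t j n (u + of_nat L)) + (\<Sum>j=Suc N..P. t j n (u + of_nat L))"
      using sum.ub_add_nat[of 1 N "\<lambda>j. t j n (u + of_nat L)" 4] by (simp add: N_def P_def add.commute[of M])
    have split2: "(\<Sum>j=1..P. t j n u) = (\<Sum>j=1..M. t j n u) + (\<Sum>j=Suc M..P. t j n u)"
      using sum.ub_add_nat[of 1 M "\<lambda>j. t j n u" 5] by (simp add: P_def)
    have main: "conv_main M n u = of_real (ln (real n)) - Digamma (u + 1) - (\<Sum>j=1..M. t j n u)"
      by (simp add: conv_main_def t_def b_def)
    show ?thesis
      unfolding power_conv_split[OF *(1), of u L] A B split1 split2 main rest_def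
      by (simp add: algebra_simps)
  qed
  ultimately show ?thesis by (simp add: unif_bigo_def)
qed


section \<open>Derivatives at exponent zero\<close>

lemma holomorphic_imp_analytic_at_0: "f holomorphic_on ball 0 1 \<Longrightarrow> f analytic_on {0 :: complex}"
  by (auto simp: analytic_at intro!: exI[of _ "ball 0 1"])

lemma higher_deriv_sum_at:
  assumes "\<And>i. i \<in> A \<Longrightarrow> f i analytic_on {z}"
  shows "(deriv ^^ n) (\<lambda>w. \<Sum>i\<in>A. f i w) z = (\<Sum>i\<in>A. (deriv ^^ n) (f i) z)"
proof (cases "finite A")
  case True
  then show ?thesis using assms
    by (induction A rule: finite_induct) (auto simp: higher_deriv_add_at analytic_on_sum)
qed auto

lemma higher_deriv_nat_powr:
  assumes "k \<ge> 1"
  shows "(deriv ^^ p) (\<lambda>u::complex. of_nat k powr u) = (\<lambda>u. of_real (ln (real k)) ^ p * of_nat k powr u)"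
proof (induction p)
  case (Suc p)
  have "((\<lambda>u. of_real (ln (real k)) ^ p * of_nat k powr u) has_field_derivative
          of_real (ln (real k)) ^ Suc p * of_nat k powr u) (at u)" for u :: complex
    using assms by (auto intro!: derivative_eq_intros simp: Ln_of_nat)
  then have "deriv (\<lambda>u::complex. of_real (ln (real k)) ^ p * of_nat k powr u)
          = (\<lambda>u. of_real (ln (real k)) ^ Suc p * of_nat k powr u)"
    by (intro ext DERIV_imp_deriv)
  then show ?case using Suc by simp
qed simp

lemma higher_deriv_Digamma_shift: "(deriv ^^ r) (\<lambda>u. Digamma (u + 1)) 0 = Polygamma r (1 :: complex)"
proof -
  have "(deriv ^^ r) (\<lambda>u. Digamma (u + 1)) z = Polygamma r (z + 1)" if "Re z > - 1" for z :: complex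
    using that
  proof (induction r arbitrary: z)
    case (Suc r)
    have "\<forall>\<^sub>F x in nhds z. Re x > - 1"
      using Suc.prems by (intro eventually_nhds_in_open[of "{x. Re x > - 1}", simplified] open_halfspace_Re_gt) auto
    then have "\<forall>\<^sub>F x in nhds z. (deriv ^^ r) (\<lambda>u. Digamma (u + 1)) x = Polygamma r (x + 1)"
      by (rule eventually_mono) (rule Suc.IH)
    then have "deriv ((deriv ^^ r) (\<lambda>u. Digamma (u + 1))) z = deriv (\<lambda>x. Polygamma r (x + 1)) z"
      by (intro deriv_cong_ev) auto
    also have "\<dots> = Polygamma (Suc r) (z + 1)"
    proof (rule DERIV_imp_deriv)
      have "z + 1 \<notin> \<int>\<^sub>\<le>\<^sub>0" using Suc.prems by (auto elim!: nonpos_Ints_cases simp: complex_eq_iff)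
      then show "((\<lambda>x. Polygamma r (x + 1)) has_field_derivative Polygamma (Suc r) (z + 1)) (at z)"
        by (auto intro!: derivative_eq_intros)
    qed
    finally show ?case by simp
  qed simp
  from this[of 0] show ?thesis by simp
qed

text \<open>
  The Taylor coefficients of $-\psi(1+u)$: both sides are given by the series $\sum_k k^{-r-1}$.
\<close>
lemma Polygamma_1_eq_zeta:
  assumes "r \<ge> 1"
  shows "Polygamma r (1 :: complex) = - ((- 1) ^ r * fact r * zeta (of_nat (r + 1)))"
proof -
  have "(\<lambda>k. inverse ((1 + of_nat k) ^ Suc r)) sums ((- 1) ^ Suc r * Polygamma r (1 :: complex) / fact r)"
    using assms by (intro Polygamma_LIMSEQ) auto
  moreover have "(\<lambda>k. of_nat (Suc k) powr (- of_nat (r + 1))) sums zeta (of_nat (r + 1))"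
    using assms by (intro zeta_sums) auto
  moreover have "of_nat (Suc k) powr (- of_nat (r + 1)) = inverse ((1 + of_nat k) ^ Suc r :: complex)" for k
  proof -
    have nz: "complex_of_nat (Suc k) \<noteq> 0" by (simp del: of_nat_Suc)
    then have "of_nat (Suc k) powr of_nat (r + 1) = (of_nat (Suc k) ^ Suc r :: complex)"
      by (subst powr_nat') auto
    then show ?thesis unfolding powr_minus by simp
  qed
  ultimately have "(- 1) ^ Suc r * Polygamma r (1 :: complex) / fact r = zeta (of_nat (r + 1))"
    using sums_unique2 by auto
  then have "Polygamma r (1 :: complex) * (- 1) ^ r = - (fact r * zeta (of_nat (r + 1)))"
    by (simp add: field_simps minus_equation_iff)
  then have "Polygamma r (1 :: complex) * ((- 1) ^ r * (- 1) ^ r) = - (fact r * zeta (of_nat (r + 1))) * (- 1) ^ r"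
    by (simp only: mult.assoc[symmetric])
  then show ?thesis by (simp flip: power_add mult_2 add: mult_ac)
qed

lemma higher_deriv_monomial_0:
  "(deriv ^^ r) (\<lambda>u::complex. c * u ^ q) 0 = (if r = q then c * fact q else 0)"
proof -
  have "(deriv ^^ r) (\<lambda>u::complex. c * u ^ q) 0 = c * (deriv ^^ r) (\<lambda>u. (u - 0) ^ q) 0"
    by (subst higher_deriv_cmult') (auto intro!: analytic_intros)
  also have "(deriv ^^ r) (\<lambda>u::complex. (u - 0) ^ q) 0 = pochhammer (of_nat (Suc q - r)) r * (0 - 0) ^ (q - r)"
    by (rule higher_deriv_power)
  also have "\<dots> = (if r = q then fact q else 0)"
    by (cases r q rule: linorder_cases) (auto simp: pochhammer_fact pochhammer_0_left)
  finally show ?thesis by auto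
qed

text \<open>
  Write the product as $(-1)^m m!\, u \prod_{i=1}^m (1 - u/i)$ and multiply out. The summation over
  sets of integers matches the encoding of the nested harmonic sums.
\<close>
lemma falling_fact_expand:
  "falling_fact u (Suc m) = (\<Sum>I\<in>Pow {1..int m}.
     (- 1) ^ m * fact m * (- 1) ^ card I * (\<Prod>i\<in>I. 1 / of_int i) * u ^ Suc (card I))"
proof -
  have "falling_fact u (Suc m) = u * (\<Prod>i<m. u - 1 - of_nat i)"
    unfolding falling_fact_Suc_shift by (simp add: falling_fact_def)
  also have "(\<Prod>i<m. u - 1 - of_nat i) = (\<Prod>i\<in>{1..int m}. u - of_int i)"
    by (rule prod.reindex_bij_witness[of _ "\<lambda>i. nat (i - 1)" "\<lambda>i. int i + 1"]) auto
  also have "\<dots> = (\<Prod>i\<in>{1..int m}. - of_int i * (1 - u / of_int i))"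
    by (intro prod.cong) (auto simp: field_simps)
  also have "\<dots> = (\<Prod>i\<in>{1..int m}. - of_int i) * (\<Prod>i\<in>{1..int m}. 1 - u / of_int i)"
    by (rule prod.distrib)
  also have "(\<Prod>i\<in>{1..int m}. - of_int i :: complex) = (- 1) ^ m * fact m"
  proof -
    have "(\<Prod>i\<in>{1..int m}. - of_int i :: complex) = (\<Prod>i\<in>{1..m}. - of_nat i)"
      by (rule prod.reindex_bij_witness[of _ int nat]) auto
    also have "\<dots> = (- 1) ^ m * fact m" by (simp add: prod_uminus fact_prod)
    finally show ?thesis .
  qed
  also have "(\<Prod>i\<in>{1..int m}. 1 - u / of_int i)
      = (\<Sum>I\<in>Pow {1..int m}. (- 1) ^ card I * (\<Prod>i\<in>I. u / of_int i) * (\<Prod>i\<in>{1..int m} - I. 1))"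
    by (rule prod_diff_conv_sum) auto
  also have "u * ((- 1) ^ m * fact m * \<dots>) = (\<Sum>I\<in>Pow {1..int m}.
     (- 1) ^ m * fact m * (- 1) ^ card I * (\<Prod>i\<in>I. 1 / of_int i) * u ^ Suc (card I))"
    unfolding sum_distrib_left
  proof (intro sum.cong refl)
    fix I :: "int set"
    have "(\<Prod>i\<in>I. u / of_int i) = u ^ card I * (\<Prod>i\<in>I. 1 / of_int i)"
      by (simp add: prod_dividef)
    then show "u * ((- 1) ^ m * fact m * ((- 1) ^ card I * (\<Prod>i\<in>I. u / of_int i) * (\<Prod>i\<in>{1..int m} - I. 1)))
        = (- 1) ^ m * fact m * (- 1) ^ card I * (\<Prod>i\<in>I. 1 / of_int i) * u ^ Suc (card I)"
      by (simp add: mult_ac)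
  qed
  finally show ?thesis .
qed

lemma higher_deriv_falling_fact_0:
  assumes "j \<ge> 1" "r \<ge> 1"
  shows "(deriv ^^ r) (\<lambda>u. falling_fact u j) 0
           = (- 1) ^ j * (- 1) ^ r * fact (j - 1) * fact r * of_real (S_sum (int r - 1) 1 (int j - 1))"
proof -
  obtain m where j: "j = Suc m" using assms by (cases j) auto
  obtain s where r: "r = Suc s" using assms by (cases r) auto
  have "(deriv ^^ r) (\<lambda>u. falling_fact u j) 0 = (\<Sum>I\<in>Pow {1..int m}. (deriv ^^ r) (\<lambda>u.
     (- 1) ^ m * fact m * (- 1) ^ card I * (\<Prod>i\<in>I. 1 / of_int i) * u ^ Suc (card I)) 0)"
    unfolding j falling_fact_expand by (rule higher_deriv_sum_at) (auto intro!: analytic_intros)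
  also have "\<dots> = (\<Sum>I\<in>Pow {1..int m}. if card I = s then
     (- 1) ^ m * fact m * (- 1) ^ s * fact r * (\<Prod>i\<in>I. 1 / of_int i) else 0)"
    unfolding higher_deriv_monomial_0 by (intro sum.cong) (auto simp: r)
  also have "\<dots> = (\<Sum>I\<in>{I \<in> Pow {1..int m}. card I = s}.
     (- 1) ^ m * fact m * (- 1) ^ s * fact r * (\<Prod>i\<in>I. 1 / of_int i))"
    by (rule sum.inter_filter[symmetric]) auto
  also have "\<dots> = (- 1) ^ m * fact m * (- 1) ^ s * fact r * (\<Sum>I | I \<subseteq> {1..int m} \<and> card I = s. \<Prod>i\<in>I. 1 / of_int i)"
    by (simp add: sum_distrib_left Pow_def)
  also have "(\<Sum>I | I \<subseteq> {1..int m} \<and> card I = s. \<Prod>i\<in>I. 1 / of_int i)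
      = complex_of_real (S_sum (int r - 1) 1 (int j - 1))"
    by (simp add: S_sum_def r j)
  finally show ?thesis by (simp add: r j)
qed

section \<open>The logarithmic sum\<close>

definition conv_error :: "nat \<Rightarrow> nat \<Rightarrow> complex \<Rightarrow> complex" where
  "conv_error M n u = power_conv n u - (of_nat n powr u * conv_main M n u + conv_zeta M n u)"

definition log_conv_term :: "nat \<Rightarrow> nat \<Rightarrow> nat \<Rightarrow> complex" where
  "log_conv_term p n k = (complex_of_real ((-1) ^ k * bernoulli k / real k ^ 2 *
                    (\<Sum>r=1..p. d_coeff p r k * ln (real n) ^ (p - r)))
                 - (-1) ^ p * (deriv ^^ p) zeta (1 - of_nat k))
                * complex_of_real (1 / real n ^ k)"

definition log_conv_error :: "nat \<Rightarrow> nat \<Rightarrow> nat \<Rightarrow> complex" where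
  "log_conv_error p m n = complex_of_real (\<Sum>k=1..n-1. ln (real k) ^ p / (real n - real k))
        - (complex_of_real (ln (real n) ^ (p + 1))
           + complex_of_real (euler_mascheroni * ln (real n) ^ p)
           + (\<Sum>r=1..p. c_coeff p r * complex_of_real (ln (real n) ^ (p - r)))
           - (\<Sum>k=1..m. log_conv_term p n k))"

lemma holomorphic_nat_powr: "n \<ge> 1 \<Longrightarrow> (\<lambda>u::complex. of_nat n powr u) holomorphic_on A"
  by (intro holomorphic_intros) auto

lemma holomorphic_Digamma_shift: "(\<lambda>u::complex. Digamma (u + 1)) holomorphic_on ball 0 1"
proof -
  have "(\<lambda>u::complex. u + 1) ` ball 0 1 \<inter> \<int>\<^sub>\<le>\<^sub>0 = {}"
  proof -
    have False if u: "u \<in> ball 0 1" "u + 1 \<in> \<int>\<^sub>\<le>\<^sub>0" for u :: complex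
    proof -
      obtain i :: int where i: "u + 1 = of_int i" "i \<le> 0"
        using u(2) by (elim nonpos_Ints_cases)
      then have "u = of_int (i - 1)" by (simp add: algebra_simps)
      then have "norm u = real_of_int \<bar>i - 1\<bar>" by (simp only: norm_of_int)
      then show False using u(1) i by simp
    qed
    then show ?thesis by blast
  qed
  then have "Digamma \<circ> (\<lambda>u::complex. u + 1) holomorphic_on ball 0 1"
    by (intro holomorphic_on_compose holomorphic_on_Polygamma holomorphic_intros)
  then show ?thesis by (simp add: o_def)
qed

lemma holomorphic_power_conv: "power_conv n holomorphic_on A"
  unfolding power_conv_def by (intro holomorphic_intros) auto

lemma holomorphic_conv_main: "n \<ge> 1 \<Longrightarrow> conv_main M n holomorphic_on ball 0 1"
  unfolding conv_main_def by (intro holomorphic_intros holomorphic_Digamma_shift) auto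

lemma holomorphic_conv_zeta: "n \<ge> 1 \<Longrightarrow> conv_zeta M n holomorphic_on ball 0 1"
  unfolding conv_zeta_def by (intro holomorphic_intros holomorphic_zeta_shift) auto

lemma higher_deriv_power_conv:
  "(deriv ^^ p) (power_conv n) 0 = of_real (\<Sum>k=1..n-1. ln (real k) ^ p / (real n - real k))"
proof -
  have "power_conv n = (\<lambda>u. \<Sum>k=1..<n. 1 / of_nat (n - k) * of_nat k powr u)"
    by (simp add: power_conv_def fun_eq_iff)
  then have "(deriv ^^ p) (power_conv n) 0 = (\<Sum>k=1..<n. (deriv ^^ p) (\<lambda>u. 1 / of_nat (n - k) * of_nat k powr u) 0)"
    by (simp only:) (intro higher_deriv_sum_at holomorphic_imp_analytic_at_0 holomorphic_intros; simp)
  also have "\<dots> = (\<Sum>k=1..<n. of_real (ln (real k) ^ p / (real n - real k)))"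
  proof (intro sum.cong refl)
    fix k assume k: "k \<in> {1..<n}"
    have "(deriv ^^ p) (\<lambda>u. 1 / of_nat (n - k) * of_nat k powr u) 0
        = 1 / complex_of_nat (n - k) * (deriv ^^ p) (\<lambda>u. of_nat k powr u) 0"
      using k by (intro higher_deriv_cmult' holomorphic_imp_analytic_at_0 holomorphic_nat_powr) auto
    also have "\<dots> = of_real (ln (real k) ^ p / (real n - real k))"
      using k by (simp add: higher_deriv_nat_powr of_nat_diff)
    finally show "(deriv ^^ p) (\<lambda>u. 1 / of_nat (n - k) * of_nat k powr u) 0 = complex_of_real (ln (real k) ^ p / (real n - real k))" .
  qed
  also have "{1..<n} = {1..n-1}" by auto
  finally show ?thesis by simp
qed

lemma higher_deriv_conv_zeta:
  assumes "n \<ge> 1"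
  shows "(deriv ^^ p) (conv_zeta M n) 0 = (\<Sum>k=1..M. (- 1) ^ p * (deriv ^^ p) zeta (1 - of_nat k) / of_nat n ^ k)"
proof -
  have "conv_zeta M n = (\<lambda>u. \<Sum>k=1..M. 1 / of_nat n ^ k * zeta (1 - of_nat k - u))"
    by (simp add: conv_zeta_def fun_eq_iff)
  then have "(deriv ^^ p) (conv_zeta M n) 0 = (\<Sum>k=1..M. (deriv ^^ p) (\<lambda>u. 1 / of_nat n ^ k * zeta (1 - of_nat k - u)) 0)"
    using assms
    by (simp only:) (intro higher_deriv_sum_at holomorphic_imp_analytic_at_0 holomorphic_intros holomorphic_zeta_shift; simp)
  also have "\<dots> = (\<Sum>k=1..M. (- 1) ^ p * (deriv ^^ p) zeta (1 - of_nat k) / of_nat n ^ k)"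
  proof (intro sum.cong refl)
    fix k assume k: "k \<in> {1..M}"
    have "(deriv ^^ p) (\<lambda>u. 1 / of_nat n ^ k * zeta (1 - of_nat k - u)) 0
        = 1 / of_nat n ^ k * (deriv ^^ p) (\<lambda>u. zeta (1 - of_nat k - u)) 0"
      using k by (intro higher_deriv_cmult' holomorphic_imp_analytic_at_0 holomorphic_zeta_shift) auto
    also have "(\<lambda>u. zeta (1 - of_nat k - u)) = (\<lambda>u. zeta (- 1 * u + (1 - of_nat k)))"
      by (simp add: algebra_simps)
    also have "(deriv ^^ p) \<dots> 0 = (- 1) ^ p * (deriv ^^ p) zeta (- 1 * 0 + (1 - of_nat k))"
    proof (rule higher_deriv_compose_linear'[OF holomorphic_zeta, of "ball 0 1"])
      fix u :: complex assume u: "u \<in> ball 0 1"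
      show "- 1 * u + (1 - of_nat k) \<in> - {1}"
      proof
        assume "- 1 * u + (1 - of_nat k) \<in> {1}"
        then have "u = - of_nat k" by (simp add: algebra_simps eq_neg_iff_add_eq_0)
        then have "norm u = real k" by simp
        then show False using u k by simp
      qed
    qed auto
    finally show "(deriv ^^ p) (\<lambda>u. 1 / of_nat n ^ k * zeta (1 - of_nat k - u)) 0
        = (- 1) ^ p * (deriv ^^ p) zeta (1 - of_nat k) / of_nat n ^ k" by simp
  qed
  finally show ?thesis .
qed

lemma higher_deriv_conv_main:
  assumes n: "n \<ge> 1" and r: "r \<ge> 1"
  shows "(deriv ^^ r) (conv_main M n) 0 = (- 1) ^ r * fact r * zeta (of_nat (r + 1))
     - (\<Sum>k=1..M. of_real ((- 1) ^ k * bernoulli k / real k ^ 2 * ((- 1) ^ r * fact r * S_sum (int r - 1) 1 (int k - 1)))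
           / of_nat n ^ k)"
proof -
  define g where "g j u = complex_of_real (bern_coeff j) / of_nat n ^ j / of_nat j * falling_fact u j" for j u
  have an: "(\<lambda>u. Digamma (u + 1)) analytic_on {0 :: complex}" "\<And>j. g j analytic_on {0}"
    using n unfolding g_def
    by (intro holomorphic_imp_analytic_at_0 holomorphic_Digamma_shift holomorphic_intros; simp)+
  have "conv_main M n = (\<lambda>u. of_real (ln (real n)) - Digamma (u + 1) - (\<Sum>j=1..M. g j u))"
    by (simp add: conv_main_def g_def fun_eq_iff)
  then have "(deriv ^^ r) (conv_main M n) 0
      = (deriv ^^ r) (\<lambda>u. of_real (ln (real n)) - Digamma (u + 1)) 0 - (deriv ^^ r) (\<lambda>u. \<Sum>j=1..M. g j u) 0"
    by (simp only:) (intro higher_deriv_diff_at analytic_on_diff analytic_on_sum an analytic_on_const)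
  also have "(deriv ^^ r) (\<lambda>u. of_real (ln (real n)) - Digamma (u + 1)) 0
      = (deriv ^^ r) (\<lambda>u::complex. of_real (ln (real n))) 0 - (deriv ^^ r) (\<lambda>u. Digamma (u + 1)) 0"
    by (intro higher_deriv_diff_at an analytic_on_const)
  also have "\<dots> = (- 1) ^ r * fact r * zeta (of_nat (r + 1))"
    using r by (simp only: higher_deriv_Digamma_shift Polygamma_1_eq_zeta[OF r] higher_deriv_const) simp
  also have "(deriv ^^ r) (\<lambda>u. \<Sum>j=1..M. g j u) 0 = (\<Sum>j=1..M. (deriv ^^ r) (g j) 0)"
    by (intro higher_deriv_sum_at an)
  also have "\<dots> = (\<Sum>k=1..M. of_real ((- 1) ^ k * bernoulli k / real k ^ 2 * ((- 1) ^ r * fact r * S_sum (int r - 1) 1 (int k - 1)))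
           / of_nat n ^ k)"
  proof (intro sum.cong refl)
    fix k assume k: "k \<in> {1..M}"
    have "(deriv ^^ r) (g k) 0 = complex_of_real (bern_coeff k) / of_nat n ^ k / of_nat k * (deriv ^^ r) (\<lambda>u. falling_fact u k) 0"
      unfolding g_def by (intro higher_deriv_cmult' holomorphic_imp_analytic_at_0 holomorphic_intros)
    also have "\<dots> = of_real (bern_coeff k * fact (k - 1) / real k * ((- 1) ^ k * ((- 1) ^ r * fact r * S_sum (int r - 1) 1 (int k - 1))))
        / of_nat n ^ k"
      using k r by (simp add: higher_deriv_falling_fact_0 mult_ac)
    also have "bern_coeff k * fact (k - 1) / real k = bernoulli k / real k ^ 2"
      using k by (cases k) (auto simp: bernoulli_eq power2_eq_square)
    finally show "(deriv ^^ r) (g k) 0 = of_real ((- 1) ^ k * bernoulli k / real k ^ 2 * ((- 1) ^ r * fact r * S_sum (int r - 1) 1 (int k - 1)))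
           / of_nat n ^ k" by (simp add: mult_ac)
  qed
  finally show ?thesis .
qed

text \<open>
  All falling factorials of positive degree vanish at $0$.
\<close>
lemma conv_main_0:
  shows "conv_main M n 0 = of_real (ln (real n)) + euler_mascheroni"
proof -
  have "falling_fact 0 j = 0" if "j \<ge> 1" for j
    using that by (cases j) (simp_all add: falling_fact_Suc_shift)
  then show ?thesis by (simp add: conv_main_def)
qed

text \<open>
  The Leibniz rule for $n^u$ times the main part; the factor $\binom{p}{r} r! = p!/(p-r)!$ in the
  coefficients $c_{p,r}$ and $d_{p,r,k}$ arises here.
\<close>
lemma higher_deriv_conv_error:
  assumes n: "n \<ge> 1"
  shows "(deriv ^^ p) (conv_error M n) 0 = log_conv_error p M n"
proof -
  define l where "l = complex_of_real (ln (real n))"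
  define U where "U r k = complex_of_real ((- 1) ^ k * bernoulli k / real k ^ 2 * ((- 1) ^ r * fact r * S_sum (int r - 1) 1 (int k - 1)))
           / of_nat n ^ k" for r k
  have an: "power_conv n analytic_on {0}" "conv_main M n analytic_on {0}" "conv_zeta M n analytic_on {0}"
      "(\<lambda>u. of_nat n powr u) analytic_on {0}"
    using n by (intro holomorphic_imp_analytic_at_0 holomorphic_power_conv holomorphic_conv_main
        holomorphic_conv_zeta holomorphic_nat_powr; simp)+
  have "(deriv ^^ p) (\<lambda>u. of_nat n powr u * conv_main M n u) 0
      = (\<Sum>i=0..p. of_nat (p choose i) * (deriv ^^ i) (\<lambda>u. of_nat n powr u) 0 * (deriv ^^ (p - i)) (conv_main M n) 0)"
    by (intro higher_deriv_mult_at an)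
  also have "\<dots> = (\<Sum>r=0..p. of_nat (p choose r) * l ^ (p - r) * (deriv ^^ r) (conv_main M n) 0)"
    using n by (intro sum.reindex_bij_witness[of _ "\<lambda>r. p - r" "\<lambda>r. p - r"])
       (auto simp: higher_deriv_nat_powr l_def binomial_symmetric[symmetric])
  also have "\<dots> = l ^ p * conv_main M n 0 + (\<Sum>r=1..p. of_nat (p choose r) * l ^ (p - r) * (deriv ^^ r) (conv_main M n) 0)"
    by (subst sum.atLeast_Suc_atMost) auto
  also have "(\<Sum>r=1..p. of_nat (p choose r) * l ^ (p - r) * (deriv ^^ r) (conv_main M n) 0)
      = (\<Sum>r=1..p. c_coeff p r * l ^ (p - r) - (\<Sum>k=1..M. of_nat (p choose r) * l ^ (p - r) * U r k))"
  proof (intro sum.cong refl)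
    fix r assume r: "r \<in> {1..p}"
    have "of_nat (p choose r) * fact r = (fact p / fact (p - r) :: complex)"
      using r by (simp add: binomial_fact)
    moreover have "of_nat (p choose r) * l ^ (p - r) * ((- 1) ^ r * fact r * zeta (of_nat (r + 1)))
        = (- 1) ^ r * (of_nat (p choose r) * fact r) * zeta (of_nat (r + 1)) * l ^ (p - r)"
      by (simp only: mult_ac)
    ultimately have "of_nat (p choose r) * l ^ (p - r) * ((- 1) ^ r * fact r * zeta (of_nat (r + 1))) = c_coeff p r * l ^ (p - r)"
      by (simp add: c_coeff_def)
    then show "of_nat (p choose r) * l ^ (p - r) * (deriv ^^ r) (conv_main M n) 0
        = c_coeff p r * l ^ (p - r) - (\<Sum>k=1..M. of_nat (p choose r) * l ^ (p - r) * U r k)"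
      using r n by (subst higher_deriv_conv_main) (auto simp: U_def right_diff_distrib sum_distrib_left)
  qed
  also have "\<dots> = (\<Sum>r=1..p. c_coeff p r * l ^ (p - r)) - (\<Sum>k=1..M. \<Sum>r=1..p. of_nat (p choose r) * l ^ (p - r) * U r k)"
    unfolding sum_subtractf by (subst (2) sum.swap) (rule refl)
  also have "(\<Sum>k=1..M. \<Sum>r=1..p. of_nat (p choose r) * l ^ (p - r) * U r k)
      = (\<Sum>k=1..M. complex_of_real ((-1) ^ k * bernoulli k / real k ^ 2 *
                    (\<Sum>r=1..p. d_coeff p r k * ln (real n) ^ (p - r))) / of_nat n ^ k)"
  proof (intro sum.cong refl)
    fix k
    have "of_nat (p choose r) * l ^ (p - r) * U r k
        = complex_of_real ((-1) ^ k * bernoulli k / real k ^ 2) * of_real (d_coeff p r k * ln (real n) ^ (p - r)) / of_nat n ^ k"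
      if r: "r \<in> {1..p}" for r
    proof -
      have "real (p choose r) * fact r = fact p / fact (p - r)"
        using r by (simp add: binomial_fact)
      then have "d_coeff p r k = (- 1) ^ r * (real (p choose r) * fact r) * S_sum (int r - 1) 1 (int k - 1)"
        by (simp add: d_coeff_def)
      then show ?thesis by (simp add: U_def l_def mult_ac)
    qed
    then have "(\<Sum>r=1..p. of_nat (p choose r) * l ^ (p - r) * U r k)
        = (\<Sum>r=1..p. complex_of_real ((-1) ^ k * bernoulli k / real k ^ 2) * of_real (d_coeff p r k * ln (real n) ^ (p - r)) / of_nat n ^ k)"
      by (rule sum.cong[OF refl])
    also have "\<dots> = complex_of_real ((-1) ^ k * bernoulli k / real k ^ 2 *
                    (\<Sum>r=1..p. d_coeff p r k * ln (real n) ^ (p - r))) / of_nat n ^ k"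
      by (simp add: sum_distrib_left sum_divide_distrib)
    finally show "(\<Sum>r=1..p. of_nat (p choose r) * l ^ (p - r) * U r k)
        = complex_of_real ((-1) ^ k * bernoulli k / real k ^ 2 *
                    (\<Sum>r=1..p. d_coeff p r k * ln (real n) ^ (p - r))) / of_nat n ^ k" .
  qed
  finally have main: "(deriv ^^ p) (\<lambda>u. of_nat n powr u * conv_main M n u) 0
      = l ^ p * (l + euler_mascheroni) + ((\<Sum>r=1..p. c_coeff p r * l ^ (p - r))
        - (\<Sum>k=1..M. complex_of_real ((-1) ^ k * bernoulli k / real k ^ 2 *
                    (\<Sum>r=1..p. d_coeff p r k * ln (real n) ^ (p - r))) / of_nat n ^ k))"
    by (simp add: conv_main_0 l_def)
  have terms: "(\<Sum>k=1..M. log_conv_term p n k)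
      = (\<Sum>k=1..M. complex_of_real ((-1) ^ k * bernoulli k / real k ^ 2 *
                    (\<Sum>r=1..p. d_coeff p r k * ln (real n) ^ (p - r))) / of_nat n ^ k)
        - (\<Sum>k=1..M. (- 1) ^ p * (deriv ^^ p) zeta (1 - of_nat k) / of_nat n ^ k)"
    unfolding sum_subtractf[symmetric] log_conv_term_def
    by (intro sum.cong refl) (simp only: of_real_divide of_real_1 of_real_power of_real_of_nat_eq
        times_divide_eq_right mult_1_right diff_divide_distrib)
  have "(deriv ^^ p) (conv_error M n) 0
      = (deriv ^^ p) (power_conv n) 0 - ((deriv ^^ p) (\<lambda>u. of_nat n powr u * conv_main M n u) 0
          + (deriv ^^ p) (conv_zeta M n) 0)"
    unfolding conv_error_def[abs_def]
    by (simp only: higher_deriv_diff_at higher_deriv_add_at analytic_on_add analytic_on_mult an)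
  also have "\<dots> = log_conv_error p M n"
    unfolding higher_deriv_power_conv main higher_deriv_conv_zeta[OF n] log_conv_error_def terms
    by (simp add: l_def algebra_simps)
  finally show ?thesis .
qed

text \<open>
  Cauchy's inequality for the $p$-th derivative on the disc of radius $1/2$.
\<close>
lemma log_conv_error_bound:
  obtains K where "K \<ge> 0" "\<And>n. n \<ge> 1 \<Longrightarrow> norm (log_conv_error p M n) \<le> K * real n powr (- real M - 1/2)"
proof -
  have "unif_bigo (- real M - 1/2) (conv_error M)"
    using power_conv_asymp[of M] by (simp add: conv_error_def[abs_def])
  then obtain C where C: "C \<ge> 0"
    "\<And>n u. n \<ge> 1 \<Longrightarrow> norm u \<le> 1/2 \<Longrightarrow> norm (conv_error M n u) \<le> C * real n powr (- real M - 1/2)"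
    using unif_bigoE by blast
  show thesis
  proof (rule that[of "fact p * C * 2 ^ p"])
    fix n :: nat assume n: "n \<ge> 1"
    have hol: "conv_error M n holomorphic_on ball 0 1"
      using n unfolding conv_error_def
      by (intro holomorphic_intros holomorphic_power_conv holomorphic_conv_main holomorphic_conv_zeta) auto
    have "norm ((deriv ^^ p) (conv_error M n) 0) \<le> fact p * (C * real n powr (- real M - 1/2)) / (1/2) ^ p"
    proof (rule Cauchy_inequality)
      show "conv_error M n holomorphic_on ball 0 (1/2)"
        using hol by (rule holomorphic_on_subset) auto
      show "continuous_on (cball 0 (1/2)) (conv_error M n)"
        using hol by (intro holomorphic_on_imp_continuous_on, elim holomorphic_on_subset) auto
    qed (use C(2)[OF n] in auto)
    then show "norm (log_conv_error p M n) \<le> fact p * C * 2 ^ p * real n powr (- real M - 1/2)"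
      using higher_deriv_conv_error[OF n] by (simp add: power_divide mult_ac)
  qed (use C in auto)
qed

text \<open>
  The uniform expansion is used up to $k = m+1$, where its error is $O(n^{-m-3/2})$. The term
  $k = m+1$ itself contains $\log n$ at most to the power $p-1$ because each falling factorial of
  positive degree vanishes at $u = 0$.
\<close>
lemma log_conv_error_bigo:
  assumes p: "p \<ge> 1"
  shows "log_conv_error p m \<in> O(\<lambda>n. complex_of_real (ln (real n) ^ (p - 1) / real n ^ (m + 1)))"
proof -
  obtain K where K: "K \<ge> 0"
    "\<And>n. n \<ge> 1 \<Longrightarrow> norm (log_conv_error p (Suc m) n) \<le> K * real n powr (- real (Suc m) - 1/2)"
    using log_conv_error_bound by blast
  define D where "D = \<bar>(- 1) ^ Suc m * bernoulli (Suc m) / real (Suc m) ^ 2\<bar> * (\<Sum>r=1..p. \<bar>d_coeff p r (Suc m)\<bar>)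
      + norm ((deriv ^^ p) zeta (1 - of_nat (Suc m)))"
  show ?thesis
  proof (rule bigoI[of _ "K + D"], use eventually_ge_at_top[of 3] in eventually_elim)
    fix n :: nat assume n: "n \<ge> 3"
    \<comment> \<open>From n = 3 on, higher powers of log n dominate lower ones.\<close>
    have ln_n: "ln (real n) \<ge> 1"
      using n exp_le by (subst ln_ge_iff) auto
    then have ln_pow: "ln (real n) ^ (p - r) \<le> ln (real n) ^ (p - 1)" if "r \<ge> 1" for r
      using that by (intro power_increasing) auto
    have ln_ge1: "ln (real n) ^ (p - 1) \<ge> 1" using ln_n by (rule one_le_power)
    have "norm (log_conv_error p (Suc m) n) \<le> K * real n powr (- real (m + 1))"
      using K(2)[of n] n mult_left_mono[OF powr_mono[of "- real (Suc m) - 1/2" "- real (m + 1)" "real n"] K(1)]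
      by simp
    also have "\<dots> = K * 1 / real n ^ (m + 1)"
      using n by (simp only: powr_minus_divide powr_realpow of_nat_0_less_iff mult_1_right) simp
    also have "\<dots> \<le> K * ln (real n) ^ (p - 1) / real n ^ (m + 1)"
      using K(1) ln_ge1 by (intro divide_right_mono mult_left_mono) auto
    finally have 1: "norm (log_conv_error p (Suc m) n) \<le> K * ln (real n) ^ (p - 1) / real n ^ (m + 1)" .
    have "\<bar>\<Sum>r=1..p. d_coeff p r (Suc m) * ln (real n) ^ (p - r)\<bar> \<le> (\<Sum>r=1..p. \<bar>d_coeff p r (Suc m)\<bar> * ln (real n) ^ (p - 1))"
    proof (rule order_trans[OF sum_abs sum_mono])
      fix r assume "r \<in> {1..p}"
      then show "\<bar>d_coeff p r (Suc m) * ln (real n) ^ (p - r)\<bar> \<le> \<bar>d_coeff p r (Suc m)\<bar> * ln (real n) ^ (p - 1)"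
        using ln_pow[of r] ln_n by (simp add: abs_mult mult_left_mono)
    qed
    then have "\<bar>(- 1) ^ Suc m * bernoulli (Suc m) / real (Suc m) ^ 2\<bar> * \<bar>\<Sum>r=1..p. d_coeff p r (Suc m) * ln (real n) ^ (p - r)\<bar>
        \<le> \<bar>(- 1) ^ Suc m * bernoulli (Suc m) / real (Suc m) ^ 2\<bar> * ((\<Sum>r=1..p. \<bar>d_coeff p r (Suc m)\<bar>) * ln (real n) ^ (p - 1))"
      unfolding sum_distrib_right by (rule mult_left_mono) simp
    moreover have "norm ((deriv ^^ p) zeta (1 - of_nat (Suc m))) * 1 \<le> norm ((deriv ^^ p) zeta (1 - of_nat (Suc m))) * ln (real n) ^ (p - 1)"
      by (rule mult_left_mono[OF ln_ge1]) simp
    moreover have "norm (complex_of_real ((- 1) ^ Suc m * bernoulli (Suc m) / real (Suc m) ^ 2 * (\<Sum>r=1..p. d_coeff p r (Suc m) * ln (real n) ^ (p - r)))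
                 - (- 1) ^ p * (deriv ^^ p) zeta (1 - of_nat (Suc m)))
        \<le> \<bar>(- 1) ^ Suc m * bernoulli (Suc m) / real (Suc m) ^ 2\<bar> * \<bar>\<Sum>r=1..p. d_coeff p r (Suc m) * ln (real n) ^ (p - r)\<bar>
          + norm ((deriv ^^ p) zeta (1 - of_nat (Suc m)))"
      by (rule order_trans[OF norm_triangle_ineq4]) (simp only: norm_of_real abs_mult norm_mult norm_power norm_minus_cancel norm_one power_one mult_1_left order_refl)
    ultimately have "norm (complex_of_real ((- 1) ^ Suc m * bernoulli (Suc m) / real (Suc m) ^ 2 * (\<Sum>r=1..p. d_coeff p r (Suc m) * ln (real n) ^ (p - r)))
                 - (- 1) ^ p * (deriv ^^ p) zeta (1 - of_nat (Suc m)))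
        \<le> D * ln (real n) ^ (p - 1)"
      unfolding D_def distrib_right mult.assoc by linarith
    then have "norm (log_conv_term p n (Suc m)) \<le> D * ln (real n) ^ (p - 1) * norm (complex_of_real (1 / real n ^ Suc m))"
      unfolding log_conv_term_def norm_mult by (rule mult_right_mono) simp
    then have 2: "norm (log_conv_term p n (Suc m)) \<le> D * ln (real n) ^ (p - 1) / real n ^ (m + 1)"
      by (simp add: norm_divide norm_power norm_mult)
    have last_term: "log_conv_error p m n = log_conv_error p (Suc m) n - log_conv_term p n (Suc m)"
      by (simp add: log_conv_error_def)
    have "norm (log_conv_error p m n) \<le> K * ln (real n) ^ (p - 1) / real n ^ (m + 1) + D * ln (real n) ^ (p - 1) / real n ^ (m + 1)"
      unfolding last_term using norm_triangle_ineq4[of "log_conv_error p (Suc m) n" "log_conv_term p n (Suc m)"] 1 2 by linarith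
    also have "\<dots> = (K + D) * norm (complex_of_real (ln (real n) ^ (p - 1) / real n ^ (m + 1)))"
      using ln_n by (simp only: norm_of_real) (simp add: add_divide_distrib distrib_right)
    finally show "norm (log_conv_error p m n) \<le> (K + D) * norm (complex_of_real (ln (real n) ^ (p - 1) / real n ^ (m + 1)))" .
  qed
qed

lemma log_conv_error_tendsto_0: "log_conv_error p 0 \<longlonglongrightarrow> 0"
proof -
  obtain K where K: "\<And>n. n \<ge> 1 \<Longrightarrow> norm (log_conv_error p 0 n) \<le> K * real n powr (- real 0 - 1/2)"
    using log_conv_error_bound by blast
  show ?thesis
  proof (rule Lim_null_comparison)
    show "\<forall>\<^sub>F n in sequentially. norm (log_conv_error p 0 n) \<le> K * real n powr (- real 0 - 1/2)"
      using eventually_ge_at_top[of 1] by eventually_elim (rule K)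
    have "(\<lambda>n. real n powr (- real 0 - 1/2)) \<longlonglongrightarrow> 0"
      by (rule tendsto_neg_powr[OF _ filterlim_real_sequentially]) simp
    from tendsto_mult_left[OF this, of K]
    show "(\<lambda>n. K * real n powr (- real 0 - 1/2)) \<longlonglongrightarrow> 0" by simp
  qed
qed

theorem lemma6p2:
  fixes p m :: nat
  assumes "p \<ge> 1" and "m \<ge> 1"
  shows
    "(\<lambda>n::nat.
        complex_of_real (\<Sum>k=1..n-1. ln (real k) ^ p / (real n - real k))
        - (complex_of_real (ln (real n) ^ (p + 1))
           + complex_of_real (euler_mascheroni * ln (real n) ^ p)
           + (\<Sum>r=1..p. c_coeff p r * complex_of_real (ln (real n) ^ (p - r)))
           - (\<Sum>k=1..m.
                (complex_of_real ((-1) ^ k * bernoulli k / real k ^ 2 *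
                    (\<Sum>r=1..p. d_coeff p r k * ln (real n) ^ (p - r)))
                 - (-1) ^ p * (deriv ^^ p) zeta (1 - of_nat k))
                * complex_of_real (1 / real n ^ k))))
      \<in> O(\<lambda>n. complex_of_real (ln (real n) ^ (p - 1) / real n ^ (m + 1)))
     \<and>
     (\<lambda>n::nat.
        complex_of_real (\<Sum>k=1..n-1. ln (real k) ^ p / (real n - real k))
        - complex_of_real (ln (real n) ^ (p + 1))
        - complex_of_real (euler_mascheroni * ln (real n) ^ p)
        - (\<Sum>r=1..<p. c_coeff p r * complex_of_real (ln (real n) ^ (p - r))))
      \<longlonglongrightarrow> (-1) ^ p * fact p * zeta (of_nat (p + 1))"
proof
  show "(\<lambda>n::nat.
        complex_of_real (\<Sum>k=1..n-1. ln (real k) ^ p / (real n - real k))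
        - (complex_of_real (ln (real n) ^ (p + 1))
           + complex_of_real (euler_mascheroni * ln (real n) ^ p)
           + (\<Sum>r=1..p. c_coeff p r * complex_of_real (ln (real n) ^ (p - r)))
           - (\<Sum>k=1..m.
                (complex_of_real ((-1) ^ k * bernoulli k / real k ^ 2 *
                    (\<Sum>r=1..p. d_coeff p r k * ln (real n) ^ (p - r)))
                 - (-1) ^ p * (deriv ^^ p) zeta (1 - of_nat k))
                * complex_of_real (1 / real n ^ k))))
      \<in> O(\<lambda>n. complex_of_real (ln (real n) ^ (p - 1) / real n ^ (m + 1)))"
    using log_conv_error_bigo[OF assms(1), of m]
    unfolding log_conv_error_def[abs_def] log_conv_term_def .
next
  have p_split: "{1..p} = insert p {1..<p}" using assms(1) by auto
  \<comment> \<open>The empty sum over k already has an error that tends to zero; only the constant r = p has to be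
      moved to the other side.\<close>
  have "(\<lambda>n. log_conv_error p 0 n + c_coeff p p) \<longlonglongrightarrow> 0 + c_coeff p p"
    by (intro tendsto_intros log_conv_error_tendsto_0)
  moreover have "log_conv_error p 0 n + c_coeff p p
      = complex_of_real (\<Sum>k=1..n-1. ln (real k) ^ p / (real n - real k))
        - complex_of_real (ln (real n) ^ (p + 1))
        - complex_of_real (euler_mascheroni * ln (real n) ^ p)
        - (\<Sum>r=1..<p. c_coeff p r * complex_of_real (ln (real n) ^ (p - r)))" for n
    unfolding log_conv_error_def p_split by simp
  moreover have "c_coeff p p = (-1) ^ p * fact p * zeta (of_nat (p + 1))"
    by (simp add: c_coeff_def)
  ultimately show "(\<lambda>n::nat.
        complex_of_real (\<Sum>k=1..n-1. ln (real k) ^ p / (real n - real k))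
        - complex_of_real (ln (real n) ^ (p + 1))
        - complex_of_real (euler_mascheroni * ln (real n) ^ p)
        - (\<Sum>r=1..<p. c_coeff p r * complex_of_real (ln (real n) ^ (p - r))))
      \<longlonglongrightarrow> (-1) ^ p * fact p * zeta (of_nat (p + 1))"
    by (simp only: add_0_left)
qed

end
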